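(* Let $j\in\{1,2\}$. Let $\xi\in L_1(\mathbb{R})$, $g(x)=\sqrt{\frac{\pi}{2}}\,e^{-|x|}$, and let $h\in L_1(\mathbb{R})$ be such that $1+(H_jh)(y)\ne0$ for all $y\in\mathbb{R}$. Then the equation $$\left(1-\frac{d^2}{dx^2}\right)\big(f \underset{H}{*} g\big)(x) + \big(f \underset{H}{*} h\big)(x)=\big(h \underset{H}{*} \xi\big)(x)$$ for the unknown function $f$ has the unique solution $f(x)=\big(\eta\underset{H}{*}\xi\big)(x)\in L_1(\mathbb{R})$, where $\eta\in L_1(\mathbb{R})$ is defined by $$(H_j\eta)(y)=\frac{(H_jh)(y)}{1+(H_jh)(y)}\quad\text{for all }y\in\mathbb{R}.$$ Moreover, $\|f\|_{L_1(\mathbb{R})}\leq\sqrt{\frac{2}{\pi}}\,\|\eta\|_{L_1(\mathbb{R})}\|\xi\|_{L_1(\mathbb{R})}$.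
   Context: The Hartley transforms are $(H_1f)(y)=\frac{1}{\sqrt{2\pi}}\int_{\mathbb{R}}f(x)(\cos(xy)+\sin(xy))\,dx$ and $(H_2f)(y)=\frac{1}{\sqrt{2\pi}}\int_{\mathbb{R}}f(x)(\cos(xy)-\sin(xy))\,dx$, $y\in\mathbb{R}$. The Hartley convolution (given by the same formula for both $H_1$ and $H_2$, and written here $\underset{H}{*}$) is $$\big(f\underset{H}{*} g\big)(x):= \frac{1}{2\sqrt{2\pi}}\int_{\mathbb{R}} f(y)\,[g(x+y) + g(x-y) + g(-x+y) - g(-x-y)]\, dy,\quad x\in\mathbb{R}.$$ *)

theory Defs
  imports "HOL-Analysis.Analysis"
begin

definition hartley1 :: "(real \<Rightarrow> complex) \<Rightarrow> real \<Rightarrow> complex" where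
  "hartley1 f y =
     (1 / sqrt (2 * pi)) *\<^sub>R (LINT x|lebesgue. f x * of_real (cos (x * y) + sin (x * y)))"

definition hartley2 :: "(real \<Rightarrow> complex) \<Rightarrow> real \<Rightarrow> complex" where
  "hartley2 f y =
     (1 / sqrt (2 * pi)) *\<^sub>R (LINT x|lebesgue. f x * of_real (cos (x * y) - sin (x * y)))"

definition hartley_conv :: "(real \<Rightarrow> complex) \<Rightarrow> (real \<Rightarrow> complex) \<Rightarrow> real \<Rightarrow> complex" where
  "hartley_conv f g x =
     (1 / (2 * sqrt (2 * pi))) *\<^sub>R
       (LINT y|lebesgue. f y * (g (x + y) + g (x - y) + g (- x + y) - g (- x - y)))"

definition L1_norm :: "(real \<Rightarrow> complex) \<Rightarrow> real" where
  "L1_norm f = (LINT x|lebesgue. norm (f x))"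

text \<open>The library has no second derivative for functions of type \<open>real \<Rightarrow> complex\<close>; the classical
  one at \<open>x\<close> requires the first derivative to exist in a neighbourhood of \<open>x\<close>.\<close>

definition has_second_derivative :: "(real \<Rightarrow> complex) \<Rightarrow> complex \<Rightarrow> real \<Rightarrow> bool" where
  "has_second_derivative u d x \<longleftrightarrow>
     (\<exists>v. (\<forall>\<^sub>F z in nhds x. (u has_vector_derivative v z) (at z)) \<and> (v has_vector_derivative d) (at x))"

text \<open>The equation is one between elements of \<open>L\<^sub>1(\<real>)\<close>, hence holds almost everywhere; the existence
  of the second derivative at almost every point is part of being a solution. For integrable \<open>f\<close>
  and \<open>g(x) = sqrt (\<pi>/2) exp (-\<bar>x\<bar>)\<close> the function \<open>f * g\<close> is continuously differentiable with locally
  absolutely continuous derivative, so the almost everywhere second derivative agrees with the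
  weak one.\<close>

definition solves_equation ::
    "(real \<Rightarrow> complex) \<Rightarrow> (real \<Rightarrow> complex) \<Rightarrow> (real \<Rightarrow> complex) \<Rightarrow> (real \<Rightarrow> complex) \<Rightarrow> bool" where
  "solves_equation g h \<xi> f \<longleftrightarrow>
     (AE x in lebesgue. \<exists>d. has_second_derivative (hartley_conv f g) d x \<and>
        (hartley_conv f g x - d) + hartley_conv f h x = hartley_conv h \<xi> x)"

end

theory Submission
  imports Defs "HOL-Probability.Probability" "HOL-Real_Asymp.Real_Asymp"
begin

text \<open>
  Let \<open>F\<close> be the Fourier transform with kernel \<open>exp (i x y)\<close>. Since \<open>cos t + s sin t\<close>, with
  \<open>s = 1\<close> or \<open>s = -1\<close>, equals \<open>a exp (i t) + (1 - a) exp (- i t)\<close> for \<open>a = (1 - s i) / 2\<close>, both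
  Hartley transforms have the form
  \<open>H f(y) = (a F f(y) + (1 - a) F f(- y)) / sqrt (2 \<pi>)\<close> with \<open>a\<^sup>2 + (1 - a)\<^sup>2 = 0\<close>.
  This quadratic relation is all that is used of the two kernels. It makes \<open>H\<close> multiplicative
  for the Hartley convolution (\<open>hartley_of_conv\<close>), it allows \<open>F f\<close> to be recovered from \<open>H f\<close>, so
  that \<open>H\<close> is injective on \<open>L\<^sub>1\<close> (\<open>hartley_of_unique\<close>), and it identifies Hartley transforms with
  Fourier transforms of other integrable functions, so that Wiener's theorem carries over
  (\<open>hartley_of_wiener\<close>) and provides \<open>\<eta>\<close>.

  The kernel \<open>g\<close> is even, so the Hartley convolution of \<open>f\<close> with \<open>g\<close> is the ordinary convolution of
  \<open>f\<close> with \<open>exp (- \<bar>x\<bar>) / 2\<close>, the fundamental solution of \<open>1 - d\<^sup>2/dx\<^sup>2\<close>. Its pointwise second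
  derivative exists at almost every point and \<open>1 - d\<^sup>2/dx\<^sup>2\<close> gives back \<open>f\<close>
  (\<open>AE_second_derivative_exp_conv\<close>). The equation therefore reads \<open>f + f * h = h * \<xi>\<close> almost
  everywhere (\<open>solves_equation_iff\<close>), with the Hartley convolution on both sides. By multiplicativity
  and injectivity this is \<open>H f (1 + H h) = H h H \<xi>\<close>, that is \<open>H f = H \<eta> H \<xi> = H (\<eta> * \<xi>)\<close>, and by
  injectivity again \<open>f = \<eta> * \<xi>\<close>. The norm estimate is the one for convolutions, applied to the four
  terms of the Hartley convolution.

  The deep part is Wiener's theorem: if \<open>k\<close> is integrable and \<open>1 + F k\<close> has no zero, then
  \<open>F k / (1 + F k)\<close> is the Fourier transform of an integrable function (\<open>wiener_inverse\<close>). The proof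
  is Newman's argument, moved from the circle to the line. The function \<open>\<bar>1 + F k\<bar>\<close> is bounded below
  by some \<open>\<delta> > 0\<close>. Approximate \<open>k\<close> within \<open>\<delta> / 3\<close> in \<open>L\<^sub>1\<close> by a function whose transform \<open>K\<close> is twice
  differentiable and decays with its derivatives like \<open>1 / (1 + y\<^sup>2)\<close> (\<open>decaying_C2_dense\<close>), and put
  \<open>P = 1 + K\<close>, \<open>R = F k - K\<close>. Then \<open>\<bar>P\<bar> \<ge> 2 \<delta> / 3\<close> and
  \<open>1 / (1 + F k) = 1 / (P + R)\<close> is the sum of \<open>(- R)^n / P^(n + 1)\<close>. By Fourier inversion the \<open>L\<^sub>1\<close> norm
  of the function with transform \<open>1 / P^(n + 1) - 1\<close> is controlled by sup norms of two derivatives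
  (\<open>fourier_of_decaying\<close>), and so grows at most like \<open>n\<^sup>2 (3 / (2 \<delta>))^n\<close>
  (\<open>fourier_ball_inverse_power\<close>), while \<open>(- R)^n\<close> contributes \<open>(\<delta> / 3)^n\<close>: the series converges in \<open>L\<^sub>1\<close>.

  All analysis is done for Borel functions and Lebesgue--Borel measure; a Lebesgue integrable
  function enters only through a Borel representative.
\<close>

section \<open>Calculus and measure-theoretic preliminaries\<close>

lemma has_vector_derivative_at_iff_quotient:
  fixes f :: "real \<Rightarrow> 'a::real_normed_vector"
  shows "(f has_vector_derivative d) (at x) \<longleftrightarrow> ((\<lambda>z. (f z - f x) /\<^sub>R (z - x)) \<longlongrightarrow> d) (at x)"
proof -
  have "norm (f z - f x - (z - x) *\<^sub>R d) / norm (z - x) = norm ((f z - f x) /\<^sub>R (z - x) - d)" if "z \<noteq> x" for z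
  proof -
    have "f z - f x - (z - x) *\<^sub>R d = (z - x) *\<^sub>R ((f z - f x) /\<^sub>R (z - x) - d)"
      using that by (simp add: scaleR_diff_right)
    then show ?thesis using that by (metis norm_scaleR nonzero_mult_div_cancel_left norm_eq_zero real_norm_def right_minus_eq)
  qed
  then have "((\<lambda>z. norm (f z - f x - (z - x) *\<^sub>R d) / norm (z - x)) \<longlongrightarrow> 0) (at x) \<longleftrightarrow>
      ((\<lambda>z. norm ((f z - f x) /\<^sub>R (z - x) - d)) \<longlongrightarrow> 0) (at x)"
    by (intro tendsto_cong) (auto simp: eventually_at_filter)
  also have "\<dots> \<longleftrightarrow> ((\<lambda>z. (f z - f x) /\<^sub>R (z - x)) \<longlongrightarrow> d) (at x)"
    by (simp add: tendsto_norm_zero_iff LIM_zero_iff)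
  finally show ?thesis
    by (simp add: has_vector_derivative_def has_derivative_iff_norm bounded_linear_scaleR_left)
qed

text \<open>Differentiation under the integral sign, by dominated convergence of the difference quotients. The
integrand is differentiable only for almost every parameter \<open>y\<close>: this admits kernels
\<open>\<phi> (x - y)\<close> with a corner at \<open>0\<close>.\<close>

lemma has_vector_derivative_integral:
  fixes f :: "real \<Rightarrow> real \<Rightarrow> complex"
  assumes int: "\<And>z. integrable lborel (f z)" and w: "integrable lborel w"
    and f'[measurable]: "f' \<in> borel_measurable borel"
    and deriv: "AE y in lborel. ((\<lambda>z. f z y) has_vector_derivative f' y) (at x)"
    and lip: "\<And>z y. norm (f z y - f x y) \<le> \<bar>z - x\<bar> * w y"
  shows "((\<lambda>z. LINT y|lborel. f z y) has_vector_derivative (LINT y|lborel. f' y)) (at x)"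
  unfolding has_vector_derivative_at_iff_quotient tendsto_at_iff_sequentially
proof (intro allI impI)
  fix X :: "nat \<Rightarrow> real"
  assume X: "\<forall>i. X i \<in> UNIV - {x}" "X \<longlonglongrightarrow> x"
  have [measurable]: "f z \<in> borel_measurable borel" for z using int[of z] by auto
  have "(\<lambda>i. LINT y|lborel. (f (X i) y - f x y) /\<^sub>R (X i - x)) \<longlonglongrightarrow> (LINT y|lborel. f' y)"
  proof (rule integral_dominated_convergence[where w=w])
    show "AE y in lborel. (\<lambda>i. (f (X i) y - f x y) /\<^sub>R (X i - x)) \<longlonglongrightarrow> f' y"
      using deriv
    proof eventually_elim
      case (elim y)
      with X show ?case
        unfolding has_vector_derivative_at_iff_quotient tendsto_at_iff_sequentially by (auto simp: o_def)
    qed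
    show "AE y in lborel. norm ((f (X i) y - f x y) /\<^sub>R (X i - x)) \<le> w y" for i
      using X(1) lip[of "X i"] by (auto simp: divide_simps mult.commute)
  qed (use w in auto)
  then show "((\<lambda>z. ((LINT y|lborel. f z y) - (LINT y|lborel. f x y)) /\<^sub>R (z - x)) \<circ> X) \<longlonglongrightarrow> (LINT y|lborel. f' y)"
    using int by (simp add: o_def)
qed

lemma negligible_AE_lborel: "negligible N \<Longrightarrow> AE x in lborel. x \<notin> N"
  by (metis AE_completion_iff AE_not_in negligible_iff_null_sets)

text \<open>Functions are changed on null sets inside integrals over \<open>y\<close> that contain \<open>g (x + y)\<close> or
\<open>g (x - y)\<close>; this keeps the exceptional set null for each fixed \<open>x\<close>.\<close>

lemma AE_lborel_affine:
  fixes c t :: real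
  assumes P: "AE x in lborel. P x" and c: "c \<noteq> 0"
  shows "AE y in lborel. P (t + c * y)"
proof -
  from P obtain N where N: "{x. \<not> P x} \<subseteq> N" "emeasure lborel N = 0" "N \<in> sets lborel"
    by (auto elim!: AE_E)
  then have [measurable]: "N \<in> sets borel" by simp
  have "(\<integral>\<^sup>+ y. indicator N y \<partial>lborel) = \<bar>c\<bar> * (\<integral>\<^sup>+ y. indicator N (t + c * y) \<partial>lborel)"
    by (rule nn_integral_real_affine) (use c in auto)
  moreover have "(\<integral>\<^sup>+ y. indicator N y \<partial>lborel) = 0" using N by simp
  ultimately have "(\<integral>\<^sup>+ y. indicator N (t + c * y) \<partial>lborel) = 0"
    using c by (simp add: ennreal_eq_0_iff)
  then have "AE y in lborel. (indicator N (t + c * y) :: ennreal) = 0"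
    by (subst (asm) nn_integral_0_iff_AE) auto
  then show ?thesis
    by eventually_elim (use N(1) in \<open>auto simp: indicator_def split: if_splits\<close>)
qed

text \<open>By completeness of Lebesgue measure, \<open>F\<close> inherits measurability from \<open>F0\<close>. This passes from
integrals of Lebesgue measurable functions to integrals of Borel representatives, where
Fubini's theorem applies.\<close>

lemma lebesgue_integral_AE_eq_lborel:
  fixes F F0 :: "real \<Rightarrow> 'b::euclidean_space"
  assumes F0: "F0 \<in> borel_measurable borel" and eq: "AE y in lborel. F y = F0 y"
  shows "(LINT y|lebesgue. F y) = (LINT y|lborel. F0 y)"
proof -
  have m: "F0 \<in> borel_measurable lebesgue" using F0 by (intro measurable_completion) simp
  have eq': "AE y in lebesgue. F0 y = F y" using eq by (subst AE_completion_iff) auto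
  have "F \<in> borel_measurable lebesgue" by (rule borel_measurable_AE[OF m eq'])
  then have "(LINT y|lebesgue. F y) = (LINT y|lebesgue. F0 y)"
    using m eq' by (intro integral_cong_AE) auto
  also have "\<dots> = (LINT y|lborel. F0 y)" using F0 by (intro integral_completion) simp
  finally show ?thesis .
qed

lemma integrable_lebesgue_of_lborel:
  fixes f :: "real \<Rightarrow> complex"
  assumes "integrable lborel f" shows "integrable lebesgue f"
  using assms borel_measurable_integrable[OF assms] by (subst integrable_completion) auto

lemma lborel_representative:
  fixes f :: "real \<Rightarrow> complex"
  assumes f: "integrable lebesgue f"
  obtains f0 where "integrable lborel f0" "AE x in lborel. f x = f0 x"
proof -
  have "(\<lambda>x. Re (f x)) \<in> borel_measurable lebesgue" "(\<lambda>x. Im (f x)) \<in> borel_measurable lebesgue"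
    using f by auto
  from this[THEN completion_ex_borel_measurable_real] obtain u v
    where [measurable]: "u \<in> borel_measurable borel" "v \<in> borel_measurable borel"
    and uv: "AE x in lborel. Re (f x) = u x" "AE x in lborel. Im (f x) = v x" by auto
  define f0 where "f0 x = of_real (u x) + \<i> * of_real (v x)" for x
  have m: "f0 \<in> borel_measurable borel" unfolding f0_def[abs_def] by measurable
  have eq: "AE x in lborel. f x = f0 x" using uv by eventually_elim (simp add: f0_def complex_eq_iff)
  have m': "f0 \<in> borel_measurable lebesgue" using m by (intro measurable_completion) simp
  have "integrable lebesgue f0"
    using f by (rule integrable_cong_AE_imp[OF _ m']) (use eq in \<open>simp add: AE_completion_iff eq_commute\<close>)
  then have "integrable lborel f0" using m by (subst (asm) integrable_completion) auto
  then show ?thesis using eq that by blast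
qed

section \<open>The Fourier transform of integrable functions\<close>

text \<open>The kernel is \<open>exp (i x y)\<close>, without normalising factor. With this choice the transform of an
ordinary convolution is the product of the transforms, and the transform is the characteristic
function in the sense of probability theory.\<close>

definition fourier :: "(real \<Rightarrow> complex) \<Rightarrow> real \<Rightarrow> complex" where
  "fourier f y = (LINT x|lborel. f x * iexp (x * y))"

lemma integrable_mult_iexp:
  assumes "integrable lborel f"
  shows "integrable lborel (\<lambda>x. f x * iexp (x * y))"
proof (rule Bochner_Integration.integrable_bound[OF assms])
  show "(\<lambda>x. f x * iexp (x * y)) \<in> borel_measurable lborel"
    using borel_measurable_integrable[OF assms] by measurable
qed (simp add: norm_mult)

lemma fourier_add:
  "integrable lborel f \<Longrightarrow> integrable lborel g \<Longrightarrow> fourier (\<lambda>x. f x + g x) y = fourier f y + fourier g y"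
  unfolding fourier_def by (simp add: distrib_right integrable_mult_iexp del: of_real_mult)

lemma fourier_diff:
  "integrable lborel f \<Longrightarrow> integrable lborel g \<Longrightarrow> fourier (\<lambda>x. f x - g x) y = fourier f y - fourier g y"
  unfolding fourier_def by (simp add: left_diff_distrib integrable_mult_iexp del: of_real_mult)

lemma fourier_cmult: "fourier (\<lambda>x. c * f x) y = c * fourier f y"
  unfolding fourier_def by (simp add: mult.assoc)

lemma integrable_reflect:
  fixes f :: "real \<Rightarrow> complex"
  shows "integrable lborel f \<Longrightarrow> integrable lborel (\<lambda>x. f (- x))"
  using lborel_integrable_real_affine[of f "-1" 0] by simp

lemma fourier_reflect: "fourier (\<lambda>x. f (- x)) y = fourier f (- y)"
  unfolding fourier_def
  using lborel_integral_real_affine[of "-1" "\<lambda>x. f x * iexp (x * - y)" 0] by simp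

lemma norm_fourier_le:
  assumes "integrable lborel f"
  shows "norm (fourier f y) \<le> (LINT x|lborel. norm (f x))"
proof -
  have "norm (fourier f y) \<le> (LINT x|lborel. norm (f x * iexp (x * y)))"
    unfolding fourier_def by (rule integral_norm_bound)
  then show ?thesis by (simp add: norm_mult)
qed

lemma fourier_measurable [measurable]:
  assumes [measurable]: "f \<in> borel_measurable borel"
  shows "fourier f \<in> borel_measurable borel"
proof -
  have "(\<lambda>y. LINT x|lborel. f x * iexp (x * y)) \<in> borel_measurable lborel"
    by (rule lborel.borel_measurable_lebesgue_integral) simp
  then show ?thesis by (simp add: fourier_def[abs_def])
qed

lemma fourier_cong_AE:
  assumes "integrable lborel u" "integrable lborel v" "AE x in lborel. u x = v x"
  shows "fourier u y = fourier v y"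
  unfolding fourier_def
proof (rule integral_cong_AE)
  show "AE x in lborel. u x * iexp (x * y) = v x * iexp (x * y)" using assms(3) by eventually_elim simp
qed (use assms(1,2)[THEN integrable_mult_iexp, of y] in \<open>auto simp del: of_real_mult\<close>)

lemma norm_iexp_diff_le: "norm (iexp a - iexp b) \<le> \<bar>a - b\<bar>"
proof -
  have "iexp a - iexp b = iexp b * (iexp (a - b) - 1)"
    by (simp add: exp_add[symmetric] right_diff_distrib)
  then show ?thesis using iexp_approx1[of "a - b" 0] by (simp add: norm_mult)
qed

lemma has_vector_derivative_iexp_mult:
  "((\<lambda>y. iexp (x * y)) has_vector_derivative \<i> * x * iexp (x * y)) (at y)"
proof -
  have "((\<lambda>z. exp (\<i> * (of_real x * z))) has_field_derivative \<i> * x * iexp (x * y)) (at (of_real y))"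
    by (auto intro!: derivative_eq_intros)
  from has_vector_derivative_real_field[OF this] show ?thesis by simp
qed

text \<open>The difference quotients of \<open>exp (i x y)\<close> in \<open>y\<close> are bounded by \<open>\<bar>x\<bar>\<close>, so \<open>x f(x)\<close> dominates.\<close>

lemma has_vector_derivative_fourier:
  fixes f :: "real \<Rightarrow> complex"
  assumes f: "integrable lborel f" and xf: "integrable lborel (\<lambda>x. \<i> * x * f x)"
  shows "(fourier f has_vector_derivative fourier (\<lambda>x. \<i> * x * f x) y) (at y)"
proof -
  have "((\<lambda>z. LINT x|lborel. f x * iexp (x * z)) has_vector_derivative (LINT x|lborel. (\<i> * x * f x) * iexp (x * y))) (at y)"
  proof (rule has_vector_derivative_integral[where w="\<lambda>x. norm (\<i> * x * f x)"])
    show "(\<lambda>x. (\<i> * x * f x) * iexp (x * y)) \<in> borel_measurable borel"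
      using xf integrable_mult_iexp[OF xf, of y] by (auto dest: borel_measurable_integrable)
    show "AE x in lborel. ((\<lambda>z. f x * iexp (x * z)) has_vector_derivative \<i> * x * f x * iexp (x * y)) (at y)"
    proof (rule AE_I2)
      fix x
      show "((\<lambda>z. f x * iexp (x * z)) has_vector_derivative \<i> * x * f x * iexp (x * y)) (at y)"
        using has_vector_derivative_mult_right[OF has_vector_derivative_iexp_mult[of x y], of "f x"]
        by (simp add: algebra_simps)
    qed
    show "norm (f x * iexp (x * z) - f x * iexp (x * y)) \<le> \<bar>z - y\<bar> * norm (\<i> * x * f x)" for z x
    proof -
      have "norm (f x * iexp (x * z) - f x * iexp (x * y)) = norm (f x) * norm (iexp (x * z) - iexp (x * y))"
        by (simp only: right_diff_distrib[symmetric] norm_mult)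
      also have "\<dots> \<le> norm (f x) * \<bar>x * z - x * y\<bar>"
        by (intro mult_left_mono norm_iexp_diff_le) simp
      also have "\<dots> = \<bar>z - y\<bar> * norm (\<i> * x * f x)"
        by (simp add: right_diff_distrib[symmetric] abs_mult norm_mult)
      finally show ?thesis .
    qed
  qed (use assms integrable_mult_iexp in auto)
  then show ?thesis by (simp add: fourier_def[abs_def])
qed

lemma continuous_fourier:
  assumes f: "integrable lborel f"
  shows "continuous_on UNIV (fourier f)"
proof (rule continuous_at_imp_continuous_on, rule ballI)
  fix y :: real
  have [measurable]: "f \<in> borel_measurable borel" using f by auto
  show "isCont (fourier f) y"
    unfolding continuous_at_sequentially
  proof (intro allI impI)
    fix X :: "nat \<Rightarrow> real"
    assume X: "X \<longlonglongrightarrow> y"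
    have "(\<lambda>n. LINT x|lborel. f x * iexp (x * X n)) \<longlonglongrightarrow> (LINT x|lborel. f x * iexp (x * y))"
      by (rule integral_dominated_convergence[where w="\<lambda>x. norm (f x)"])
         (use f X in \<open>auto simp: norm_mult intro!: tendsto_intros\<close>)
    then show "(fourier f \<circ> X) \<longlonglongrightarrow> fourier f y" by (simp add: fourier_def o_def)
  qed
qed

section \<open>Convolutions with reflected arguments\<close>

text \<open>The four terms of the Hartley convolution are the cases \<open>s, t \<in> {1, -1}\<close>; the ordinary convolution
is \<open>s = 1\<close>, \<open>t = -1\<close>.\<close>

definition signed_conv :: "real \<Rightarrow> real \<Rightarrow> (real \<Rightarrow> complex) \<Rightarrow> (real \<Rightarrow> complex) \<Rightarrow> real \<Rightarrow> complex" where
  "signed_conv s t f g x = (LINT y|lborel. f y * g (s * x + t * y))"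

context
  fixes s t :: real and f g :: "real \<Rightarrow> complex"
  assumes s: "\<bar>s\<bar> = 1" and f: "integrable lborel f" and g: "integrable lborel g"
begin

lemma signed_conv_integrable_pair:
  "integrable (lborel \<Otimes>\<^sub>M lborel) (\<lambda>(x, y). f y * g (s * x + t * y))"
proof -
  have [measurable]: "f \<in> borel_measurable borel" "g \<in> borel_measurable borel"
    using f g by auto
  have s0: "s \<noteq> 0" using s by auto
  have gi: "integrable lborel (\<lambda>x. g (t * y + s * x))" for y
    using lborel_integrable_real_affine[OF g s0] by simp
  have gn: "(LINT x|lborel. norm (g (t * y + s * x))) = (LINT x|lborel. norm (g x))" for y
    using lborel_integral_real_affine[OF s0, of "\<lambda>x. norm (g x)" "t * y"] s by simp
  \<comment> \<open>The inner integral is taken over \<open>x\<close>: for fixed \<open>y\<close> the factor with \<open>g\<close> is a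
translate of \<open>g\<close> or of its reflection, whereas for fixed
\<open>x\<close> the product may fail to be integrable in \<open>y\<close>.\<close>
  have "integrable (lborel \<Otimes>\<^sub>M lborel) (\<lambda>(y, x). f y * g (t * y + s * x))"
  proof (rule lborel_pair.Fubini_integrable)
    show "(\<lambda>(y, x). f y * g (t * y + s * x)) \<in> borel_measurable (lborel \<Otimes>\<^sub>M lborel)"
      by measurable
    show "integrable lborel (\<lambda>y. LINT x|lborel. norm (case (y, x) of (y, x) \<Rightarrow> f y * g (t * y + s * x)))"
      using f by (simp add: norm_mult gn)
    show "AE y in lborel. integrable lborel (\<lambda>x. case (y, x) of (y, x) \<Rightarrow> f y * g (t * y + s * x))"
      using gi by simp
  qed
  from lborel_pair.integrable_product_swap[OF this] show ?thesis
    by (simp add: case_prod_unfold add.commute)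
qed

lemma AE_signed_conv_integrable: "AE x in lborel. integrable lborel (\<lambda>y. f y * g (s * x + t * y))"
  using lborel_pair.AE_integrable_fst[OF signed_conv_integrable_pair] .

lemma integrable_signed_conv: "integrable lborel (signed_conv s t f g)"
  unfolding signed_conv_def[abs_def] using lborel_pair.integrable_fst[OF signed_conv_integrable_pair] .

lemma norm_signed_conv_le:
  "(LINT x|lborel. norm (signed_conv s t f g x)) \<le> (LINT x|lborel. norm (f x)) * (LINT x|lborel. norm (g x))"
proof -
  have s0: "s \<noteq> 0" using s by auto
  have gn: "(LINT x|lborel. norm (g (s * x + t * y))) = (LINT x|lborel. norm (g x))" for y
    using lborel_integral_real_affine[OF s0, of "\<lambda>x. norm (g x)" "t * y"] s by (simp add: add.commute)
  have P: "integrable (lborel \<Otimes>\<^sub>M lborel) (\<lambda>(x, y). norm (f y * g (s * x + t * y)))"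
    using integrable_norm[OF signed_conv_integrable_pair] by (simp add: case_prod_unfold)
  have "(LINT x|lborel. norm (signed_conv s t f g x)) \<le> (LINT x|lborel. LINT y|lborel. norm (f y * g (s * x + t * y)))"
    by (intro integral_mono integrable_norm integrable_signed_conv lborel_pair.integrable_fst[OF P])
       (auto simp: signed_conv_def)
  also have "\<dots> = (LINT y|lborel. LINT x|lborel. norm (f y * g (s * x + t * y)))"
    using lborel_pair.Fubini_integral[OF P] by simp
  also have "\<dots> = (LINT x|lborel. norm (f x)) * (LINT x|lborel. norm (g x))"
    by (simp add: norm_mult gn)
  finally show ?thesis .
qed

lemma fourier_signed_conv: "fourier (signed_conv s t f g) l = fourier f (- (s * t * l)) * fourier g (s * l)"
proof -
  have s0: "s \<noteq> 0" and ss: "s * s = 1" using s by (auto simp: abs_if split: if_splits)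
  have P: "integrable (lborel \<Otimes>\<^sub>M lborel) (\<lambda>(x, y). f y * g (s * x + t * y) * iexp (x * l))"
  proof (rule Bochner_Integration.integrable_bound[OF signed_conv_integrable_pair])
    have [measurable]: "f \<in> borel_measurable borel" "g \<in> borel_measurable borel"
      using f g by auto
    show "(\<lambda>(x, y). f y * g (s * x + t * y) * iexp (x * l)) \<in> borel_measurable (lborel \<Otimes>\<^sub>M lborel)"
      by measurable
  qed (simp add: case_prod_unfold norm_mult)
  have inner: "(LINT x|lborel. f y * g (s * x + t * y) * iexp (x * l)) = f y * iexp (y * - (s * t * l)) * fourier g (s * l)" for y
  proof -
    have "(LINT x|lborel. g x * iexp (s * (x - t * y) * l)) = (LINT x|lborel. g (s * x + t * y) * iexp (x * l))"
      using lborel_integral_real_affine[OF s0, of "\<lambda>x. g x * iexp (s * (x - t * y) * l)" "t * y"] s ss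
      by (simp add: add.commute mult.assoc[symmetric])
    moreover have "g x * iexp (s * (x - t * y) * l) = iexp (y * - (s * t * l)) * (g x * iexp (x * (s * l)))" for x
      by (simp add: exp_add[symmetric] algebra_simps)
    ultimately have "(LINT x|lborel. g (s * x + t * y) * iexp (x * l)) = iexp (y * - (s * t * l)) * fourier g (s * l)"
      by (simp add: fourier_def del: of_real_mult)
    then show ?thesis by (simp add: mult.assoc del: of_real_mult)
  qed
  have "fourier (signed_conv s t f g) l = (LINT x|lborel. LINT y|lborel. f y * g (s * x + t * y) * iexp (x * l))"
    by (simp add: fourier_def signed_conv_def)
  also have "\<dots> = (LINT y|lborel. LINT x|lborel. f y * g (s * x + t * y) * iexp (x * l))"
    using lborel_pair.Fubini_integral[OF P] by simp
  also have "\<dots> = (LINT y|lborel. f y * iexp (y * - (s * t * l)) * fourier g (s * l))"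
    by (simp only: inner)
  also have "\<dots> = fourier f (- (s * t * l)) * fourier g (s * l)"
    by (simp add: fourier_def)
  finally show ?thesis .
qed

end

section \<open>Injectivity and inversion of the Fourier transform\<close>

lemma real_distribution_density:
  fixes u :: "real \<Rightarrow> real"
  assumes u: "integrable lborel u" and nn: "\<And>x. 0 \<le> u x" and one: "(LINT x|lborel. u x) = 1"
  shows "real_distribution (density lborel u)"
    and "char (density lborel u) y = (LINT x|lborel. of_real (u x) * iexp (x * y))"
proof -
  have [measurable]: "u \<in> borel_measurable borel" using u by auto
  have "emeasure (density lborel u) UNIV = 1"
    using nn_integral_eq_integral[OF u] nn one by (simp add: emeasure_density)
  then show "real_distribution (density lborel u)"
    by (intro real_distribution.intro prob_spaceI real_distribution_axioms.intro) auto
  show "char (density lborel u) y = (LINT x|lborel. of_real (u x) * iexp (x * y))"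
    unfolding char_def using nn by (subst integral_density) (auto simp: scaleR_conv_of_real mult.commute)
qed

text \<open>The positive and negative parts of \<open>u\<close> have the same transform, in particular the same mass
\<open>m\<close>, which is the transform at \<open>0\<close>. Divided by \<open>m\<close> they are densities of probability measures with
the same characteristic function, and Levy's uniqueness theorem applies.\<close>

lemma real_fourier_unique:
  fixes u :: "real \<Rightarrow> real"
  assumes u: "integrable lborel u" and z: "\<And>y. fourier (\<lambda>x. of_real (u x)) y = 0"
  shows "AE x in lborel. u x = 0"
proof -
  have [measurable]: "u \<in> borel_measurable borel" using u by auto
  define p where "p x = max 0 (u x)" for x
  define n where "n x = max 0 (- u x)" for x
  have p: "integrable lborel p" and n: "integrable lborel n"
    unfolding p_def n_def using u by auto
  have [measurable]: "p \<in> borel_measurable borel" "n \<in> borel_measurable borel" using p n by auto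
  have upn: "u x = p x - n x" for x by (auto simp: p_def n_def)
  have pn: "fourier (\<lambda>x. of_real (p x)) y = fourier (\<lambda>x. of_real (n x)) y" for y
    using z[of y] fourier_diff[of "\<lambda>x. of_real (p x)" "\<lambda>x. of_real (n x)" y] p n
    by (simp add: upn)
  define m where "m = (LINT x|lborel. p x)"
  have mn: "m = (LINT x|lborel. n x)"
    using pn[of 0] by (simp add: fourier_def m_def)
  have m0: "0 \<le> m" unfolding m_def by (simp add: p_def)
  show ?thesis
  proof (cases "m = 0")
    case True
    have "AE x in lborel. p x = 0"
      using integral_nonneg_eq_0_iff_AE[OF p] True by (simp add: m_def[symmetric]) (simp add: p_def)
    moreover have "AE x in lborel. n x = 0"
      using integral_nonneg_eq_0_iff_AE[OF n] True by (simp add: mn[symmetric]) (simp add: n_def)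
    ultimately show ?thesis by eventually_elim (simp add: upn)
  next
    case False
    then have m: "0 < m" using m0 by simp
    let ?P = "\<lambda>x. p x / m" and ?N = "\<lambda>x. n x / m"
    have iP: "integrable lborel ?P" "\<And>x. 0 \<le> ?P x" "(LINT x|lborel. ?P x) = 1"
      using p m by (simp, simp add: p_def, simp add: m_def[symmetric])
    have iN: "integrable lborel ?N" "\<And>x. 0 \<le> ?N x" "(LINT x|lborel. ?N x) = 1"
      using n m by (simp, simp add: n_def, simp add: mn[symmetric])
    have "char (density lborel ?P) y = char (density lborel ?N) y" for y
      using pn[of y] unfolding real_distribution_density(2)[OF iP] real_distribution_density(2)[OF iN]
      by (simp add: fourier_def)
    then have "density lborel ?P = density lborel ?N"
      by (intro Levy_uniqueness real_distribution_density(1) iP iN ext)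
    then have "AE x in lborel. ennreal (?P x) = ennreal (?N x)"
      by (subst sigma_finite_measure.density_unique_iff[OF lborel.sigma_finite_measure_axioms, symmetric]) auto
    then show ?thesis
    proof eventually_elim
      case (elim x)
      then have "?P x = ?N x" using iP(2) iN(2) by (metis ennreal_inj)
      then show ?case using m by (simp add: upn)
    qed
  qed
qed

text \<open>Conjugation maps functions with vanishing transform to such functions, so the real and imaginary
parts of \<open>f\<close> have vanishing transform too.\<close>

lemma fourier_unique:
  assumes f: "integrable lborel f" and z: "\<And>y. fourier f y = 0"
  shows "AE x in lborel. f x = 0"
proof -
  have c: "fourier (\<lambda>x. cnj (f x)) y = 0" for y
  proof -
    have "fourier (\<lambda>x. cnj (f x)) y = cnj (fourier f (- y))"
    proof -
      have "fourier (\<lambda>x. cnj (f x)) y = (LINT x|lborel. cnj (f x * iexp (x * - y)))"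
        unfolding fourier_def by (intro Bochner_Integration.integral_cong) (auto simp: exp_cnj)
      then show ?thesis
        unfolding fourier_def by (simp only: Bochner_Integration.integral_cnj)
    qed
    then show ?thesis using z by simp
  qed
  have fc: "integrable lborel (\<lambda>x. cnj (f x))" using f by simp
  have "fourier (\<lambda>x. of_real (Re (f x))) y = 0" for y
  proof -
    have "of_real (Re (f x)) = (1/2) * (f x + cnj (f x))" for x by (simp add: complex_eq_iff)
    then show ?thesis by (simp only: fourier_cmult fourier_add[OF f fc] z c) simp
  qed
  then have "AE x in lborel. Re (f x) = 0" using f by (intro real_fourier_unique) auto
  moreover have "fourier (\<lambda>x. of_real (Im (f x))) y = 0" for y
  proof -
    have "of_real (Im (f x)) = (- \<i>/2) * (f x - cnj (f x))" for x by (simp add: complex_eq_iff)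
    then show ?thesis by (simp only: fourier_cmult fourier_diff[OF f fc] z c) simp
  qed
  then have "AE x in lborel. Im (f x) = 0" using f by (intro real_fourier_unique) auto
  ultimately show ?thesis by eventually_elim (simp add: complex_eq_iff)
qed

lemma gaussian_integral_scaled:
  assumes e: "0 < e"
  shows "(LINT x|lborel. iexp (x * u) * of_real (exp (- (e * x)\<^sup>2 / 2))) = of_real (sqrt (2 * pi) / e * exp (- (u / e)\<^sup>2 / 2))"
proof -
  have "(LINT x|lborel. of_real (std_normal_density x) * iexp (x * t)) = of_real (exp (- t\<^sup>2 / 2))" for t
    using real_distribution_density(2)[of std_normal_density t] char_std_normal_distribution
    by (simp add: normal_density_nonneg del: of_real_mult)
  then have *: "(LINT x|lborel. iexp (x * t) * of_real (exp (- x\<^sup>2 / 2))) = of_real (sqrt (2 * pi) * exp (- t\<^sup>2 / 2))" for t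
  proof -
    have "of_real (std_normal_density x) * iexp (x * t)
        = of_real (1 / sqrt (2 * pi)) * (iexp (x * t) * of_real (exp (- x\<^sup>2 / 2)))" for x
      by (simp add: normal_density_def)
    with \<open>\<And>t. _ = of_real (exp (- t\<^sup>2 / 2))\<close>[of t]
    have "of_real (1 / sqrt (2 * pi)) * (LINT x|lborel. iexp (x * t) * of_real (exp (- x\<^sup>2 / 2))) = complex_of_real (exp (- t\<^sup>2 / 2))"
      by (simp only: integral_mult_right_zero)
    then show ?thesis by (simp add: field_simps del: of_real_exp)
  qed
  show ?thesis
    using e lborel_integral_real_affine[of e "\<lambda>x. iexp (x * (u / e)) * of_real (exp (- x\<^sup>2 / 2))" 0] *[of "u / e"]
    by (simp add: scaleR_conv_of_real field_simps)
qed

lemma integrable_exp_neg_square: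
  assumes e: "0 < e"
  shows "integrable lborel (\<lambda>x::real. exp (- (e * x)\<^sup>2 / 2))"
proof -
  have "integrable lborel (\<lambda>x. sqrt (2 * pi) * std_normal_density x)" by simp
  then have "integrable lborel (\<lambda>x::real. exp (- x\<^sup>2 / 2))"
    by (simp add: normal_density_def)
  from lborel_integrable_real_affine[OF this, of e 0] e show ?thesis by simp
qed

text \<open>Damp the transform integral of \<open>g\<close> by the Gaussian \<open>exp (- (e x)\<^sup>2 / 2)\<close>. Fubini turns it into the
average of \<open>G\<close> around \<open>y\<close> against a Gaussian of width \<open>e\<close>, and \<open>e \<rightarrow> 0\<close> gives \<open>G y\<close> by
continuity.\<close>

lemma fourier_inversion:
  assumes G: "integrable lborel G" and cont: "continuous_on UNIV G" and bdd: "\<And>t. norm (G t) \<le> B"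
    and g_def: "g = (\<lambda>x. fourier G (- x) / (2 * pi))"
    and g: "integrable lborel g"
  shows "fourier g y = G y"
proof -
  have [measurable]: "G \<in> borel_measurable borel" "g \<in> borel_measurable borel" using G g by auto
  define e :: "nat \<Rightarrow> real" where "e n = 1 / Suc n" for n
  have e: "0 < e n" for n by (simp add: e_def)
  have e0: "e \<longlonglongrightarrow> 0" unfolding e_def[abs_def] using LIMSEQ_inverse_real_of_nat by (simp add: inverse_eq_divide)
  let ?w = "\<lambda>n x. of_real (exp (- (e n * x)\<^sup>2 / 2)) :: complex"
  have damped: "(\<lambda>n. LINT x|lborel. g x * iexp (x * y) * ?w n x) \<longlonglongrightarrow> (LINT x|lborel. g x * iexp (x * y))"
  proof (rule integral_dominated_convergence[where w="\<lambda>x. norm (g x)"])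
    show "AE x in lborel. (\<lambda>n. g x * iexp (x * y) * ?w n x) \<longlonglongrightarrow> g x * iexp (x * y)"
    proof (rule AE_I2)
      fix x :: real
      have "(\<lambda>n. g x * iexp (x * y) * ?w n x) \<longlonglongrightarrow> g x * iexp (x * y) * of_real (exp (- (0 * x)\<^sup>2 / 2))"
        by (intro tendsto_intros e0) simp
      then show "(\<lambda>n. g x * iexp (x * y) * ?w n x) \<longlonglongrightarrow> g x * iexp (x * y)" by simp
    qed
  qed (use g in \<open>auto simp: norm_mult mult_left_le\<close>)
  have swap: "(LINT x|lborel. g x * iexp (x * y) * ?w n x)
      = of_real (1 / sqrt (2 * pi)) * (LINT s|lborel. G (y + e n * s) * of_real (exp (- s\<^sup>2 / 2)))" for n
  proof -
    have P: "integrable (lborel \<Otimes>\<^sub>M lborel) (\<lambda>(x, t). G t * iexp (x * (y - t)) * ?w n x)"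
    proof (rule lborel_pair.Fubini_integrable)
      show "(\<lambda>(x, t). G t * iexp (x * (y - t)) * ?w n x) \<in> borel_measurable (lborel \<Otimes>\<^sub>M lborel)"
        by measurable
      show "integrable lborel (\<lambda>x. LINT t|lborel. norm (case (x, t) of (x, t) \<Rightarrow> G t * iexp (x * (y - t)) * ?w n x))"
        using integrable_exp_neg_square[OF e] by (simp add: norm_mult)
      have "integrable lborel (\<lambda>t. G t * iexp (x * (y - t)) * ?w n x)" for x
        by (rule Bochner_Integration.integrable_bound[OF G]) (auto simp: norm_mult mult_left_le)
      then show "AE x in lborel. integrable lborel (\<lambda>t. case (x, t) of (x, t) \<Rightarrow> G t * iexp (x * (y - t)) * ?w n x)"
        by simp
    qed
    have "g x * iexp (x * y) * ?w n x = (LINT t|lborel. G t * iexp (x * (y - t)) * ?w n x) / (2 * pi)" for x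
    proof -
      have "iexp (t * - x) * iexp (x * y) = iexp (x * (y - t))" for t
        by (simp add: exp_add[symmetric] algebra_simps)
      then have "G t * iexp (t * - x) * (iexp (x * y) * ?w n x) = G t * iexp (x * (y - t)) * ?w n x" for t
        by (simp only: mult.assoc[symmetric]) (simp only: mult.assoc)
      then have "fourier G (- x) * (iexp (x * y) * ?w n x) = (LINT t|lborel. G t * iexp (x * (y - t)) * ?w n x)"
        unfolding fourier_def integral_mult_left_zero[symmetric] by (simp only:)
      then show ?thesis unfolding g_def by (simp only: times_divide_eq_left mult.assoc)
    qed
    then have "(LINT x|lborel. g x * iexp (x * y) * ?w n x)
        = (LINT x|lborel. LINT t|lborel. G t * iexp (x * (y - t)) * ?w n x) / (2 * pi)"
      by (simp only: integral_divide_zero)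
    also have "\<dots> = (LINT t|lborel. LINT x|lborel. G t * iexp (x * (y - t)) * ?w n x) / (2 * pi)"
      using lborel_pair.Fubini_integral[OF P] by simp
    also have "\<dots> = (LINT t|lborel. G t * of_real (sqrt (2 * pi) / e n * exp (- ((y - t) / e n)\<^sup>2 / 2))) / (2 * pi)"
      by (simp only: mult.assoc integral_mult_right_zero gaussian_integral_scaled[OF e])
    also have "(LINT t|lborel. G t * of_real (sqrt (2 * pi) / e n * exp (- ((y - t) / e n)\<^sup>2 / 2)))
        = (LINT s|lborel. of_real (sqrt (2 * pi)) * (G (y + e n * s) * of_real (exp (- s\<^sup>2 / 2))))"
      using e[of n] unfolding lborel_integral_real_affine[OF less_imp_neq[OF e[of n], symmetric],
          of "\<lambda>t. G t * of_real (sqrt (2 * pi) / e n * exp (- ((y - t) / e n)\<^sup>2 / 2))" y] integral_scaleR_right[symmetric]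
      by (intro Bochner_Integration.integral_cong) (auto simp: scaleR_conv_of_real field_simps)
    also have "\<dots> / (2 * pi) = of_real (1 / sqrt (2 * pi)) * (LINT s|lborel. G (y + e n * s) * of_real (exp (- s\<^sup>2 / 2)))"
    proof -
      have "of_real (sqrt (2 * pi)) * Z / of_real (2 * pi) = of_real (1 / sqrt (2 * pi)) * Z" for Z :: complex
      proof -
        have "(2 * pi) = sqrt (2 * pi) * sqrt (2 * pi)" by simp
        then have "of_real (sqrt (2 * pi)) * Z / of_real (2 * pi) = of_real (sqrt (2 * pi)) * Z / of_real (sqrt (2 * pi) * sqrt (2 * pi))" by simp
        also have "\<dots> = of_real (1 / sqrt (2 * pi)) * Z" by (simp add: field_simps del: real_sqrt_mult_self)
        finally show ?thesis .
      qed
      then show ?thesis by (simp only: integral_mult_right_zero)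
    qed
    finally show ?thesis .
  qed
  have kernel: "(\<lambda>n. of_real (1 / sqrt (2 * pi)) * (LINT s|lborel. G (y + e n * s) * of_real (exp (- s\<^sup>2 / 2))))
      \<longlonglongrightarrow> of_real (1 / sqrt (2 * pi)) * (LINT s|lborel. G y * of_real (exp (- s\<^sup>2 / 2)))"
  proof (intro tendsto_mult tendsto_const integral_dominated_convergence[where w="\<lambda>s. B * exp (- s\<^sup>2 / 2)"])
    show "integrable lborel (\<lambda>s. B * exp (- s\<^sup>2 / 2))"
      using integrable_exp_neg_square[of 1] by simp
    show "AE s in lborel. (\<lambda>n. G (y + e n * s) * of_real (exp (- s\<^sup>2 / 2))) \<longlonglongrightarrow> G y * of_real (exp (- s\<^sup>2 / 2))"
    proof (rule AE_I2)
      fix s :: real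
      have "isCont G (y + 0 * s)" using cont by (simp add: continuous_on_eq_continuous_at)
      then have "(\<lambda>n. G (y + e n * s)) \<longlonglongrightarrow> G (y + 0 * s)"
        by (rule isCont_tendsto_compose) (intro tendsto_intros e0)
      then show "(\<lambda>n. G (y + e n * s) * of_real (exp (- s\<^sup>2 / 2))) \<longlonglongrightarrow> G y * of_real (exp (- s\<^sup>2 / 2))"
        by (intro tendsto_intros) simp
    qed
  qed (use bdd in \<open>auto simp: norm_mult\<close>)
  have mass: "of_real (1 / sqrt (2 * pi)) * (LINT s|lborel. G y * of_real (exp (- s\<^sup>2 / 2))) = G y"
    using gaussian_integral_scaled[of 1 0] by (simp del: of_real_exp)
  show ?thesis
    unfolding fourier_def by (rule LIMSEQ_unique[OF damped kernel[folded swap, unfolded mass]])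
qed

text \<open>The candidate is the inverse transform \<open>g\<close> of \<open>G\<close>. The integrals of \<open>\<bar>G\<bar>\<close> and of \<open>\<bar>G''\<bar>\<close> are at most
\<open>\<pi> B\<close>, which bounds \<open>2 \<pi> \<bar>g(x)\<bar>\<close> and \<open>2 \<pi> x\<^sup>2 \<bar>g(x)\<bar>\<close>. Hence \<open>\<bar>g(x)\<bar> \<le> B / (1 + x\<^sup>2)\<close>, which is
integrable with integral \<open>\<pi> B\<close>. The explicit norm bound is what Newman's argument needs.\<close>

lemma fourier_of_decaying:
  assumes d1: "\<And>y. (G has_vector_derivative G1 y) (at y)" and d2: "\<And>y. (G1 has_vector_derivative G2 y) (at y)"
    and cont: "continuous_on UNIV G2"
    and b0: "\<And>y. norm (G y) \<le> B / (1 + y\<^sup>2)" and b1: "\<And>y. norm (G1 y) \<le> B / (1 + y\<^sup>2)"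
    and b2: "\<And>y. norm (G2 y) \<le> B / (1 + y\<^sup>2)"
  shows "\<exists>g. integrable lborel g \<and> (\<forall>y. fourier g y = G y) \<and> (LINT x|lborel. norm (g x)) \<le> pi * B"
proof -
  have w: "integrable lborel (\<lambda>y. B / (1 + y\<^sup>2))" "(LINT y|lborel. B / (1 + y\<^sup>2)) = pi * B"
    using integrable_inverse_1_plus_square LBINT_inverse_1_plus_square
    by (simp_all add: interval_lebesgue_integral_def einterval_def set_lebesgue_integral_def
        set_integrable_def divide_inverse)
  have cG: "continuous_on UNIV G" 
    using d1 by (meson continuous_at_imp_continuous_on has_vector_derivative_continuous)
  have cG1: "continuous_on UNIV G1" 
    using d2 by (meson continuous_at_imp_continuous_on has_vector_derivative_continuous)
  have [measurable]: "G \<in> borel_measurable borel" "G1 \<in> borel_measurable borel" "G2 \<in> borel_measurable borel"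
    using cG cG1 cont by (auto intro: borel_measurable_continuous_onI)
  have B: "0 \<le> B" using order_trans[OF norm_ge_zero b0[of 0]] by simp
  have iG: "integrable lborel G" 
    by (rule Bochner_Integration.integrable_bound[OF w(1)]) (use B b0 in auto)
  have iG2: "integrable lborel G2"
    by (rule Bochner_Integration.integrable_bound[OF w(1)]) (use B b2 in auto)
  have nG: "(LINT x|lborel. norm (G x)) \<le> pi * B" and nG2: "(LINT x|lborel. norm (G2 x)) \<le> pi * B"
    unfolding w(2)[symmetric] by (intro integral_mono w(1) integrable_norm iG iG2 b0 b2)+
  have parts: "fourier G2 (- x) = - (x\<^sup>2) * fourier G (- x)" for x
  proof -
    \<comment> \<open>Two integrations by parts in one step: \<open>?F\<close> is a primitive of \<open>?f\<close> and vanishes at both ends.\<close>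
    let ?f = "\<lambda>y. (G2 y + x\<^sup>2 * G y) * iexp (y * - x)"
    let ?F = "\<lambda>y. (G1 y + \<i> * x * G y) * iexp (y * - x)"
    have fi: "integrable lborel ?f"
      by (intro integrable_mult_iexp Bochner_Integration.integrable_add iG2 integrable_mult_right iG)
    have e: "((\<lambda>y. iexp (y * - x)) has_vector_derivative - \<i> * x * iexp (y * - x)) (at y)" for y
      using has_vector_derivative_iexp_mult[of "- x" y] by (simp add: mult.commute)
    have "(?F has_vector_derivative (G1 y + \<i> * x * G y) * (- \<i> * x * iexp (y * - x))
        + (G2 y + \<i> * x * G1 y) * iexp (y * - x)) (at y)" for y
      by (intro has_vector_derivative_mult has_vector_derivative_add has_vector_derivative_mult_right d1 d2 e)
    moreover have "(G1 y + \<i> * x * G y) * (- \<i> * x * iexp (y * - x)) + (G2 y + \<i> * x * G1 y) * iexp (y * - x) = ?f y" for y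
      by (simp add: algebra_simps power2_eq_square)
    ultimately have d: "(?F has_vector_derivative ?f y) (at y)" for y
      by (simp only:)
    have lim: "(?F \<longlongrightarrow> 0) at_top" "(?F \<longlongrightarrow> 0) at_bot"
    proof -
      have bnd: "norm (?F y) \<le> (1 + \<bar>x\<bar>) * (B / (1 + y\<^sup>2))" for y
      proof -
        have "norm (?F y) \<le> norm (G1 y) + \<bar>x\<bar> * norm (G y)"
          using norm_triangle_ineq[of "G1 y" "\<i> * x * G y"] by (simp add: norm_mult)
        also have "\<dots> \<le> B / (1 + y\<^sup>2) + \<bar>x\<bar> * (B / (1 + y\<^sup>2))"
          by (intro add_mono mult_left_mono b0 b1) auto
        also have "\<dots> = (1 + \<bar>x\<bar>) * (B / (1 + y\<^sup>2))" by (simp only: distrib_right mult_1)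
        finally show ?thesis .
      qed
      have null: "((\<lambda>y::real. (1 + \<bar>x\<bar>) * (B / (1 + y\<^sup>2))) \<longlongrightarrow> 0) at_top"
        "((\<lambda>y::real. (1 + \<bar>x\<bar>) * (B / (1 + y\<^sup>2))) \<longlongrightarrow> 0) at_bot"
      proof -
        have "((\<lambda>y::real. inverse (1 + y\<^sup>2)) \<longlongrightarrow> 0) at_top" "((\<lambda>y::real. inverse (1 + y\<^sup>2)) \<longlongrightarrow> 0) at_bot"
          by real_asymp+
        then show "((\<lambda>y::real. (1 + \<bar>x\<bar>) * (B / (1 + y\<^sup>2))) \<longlongrightarrow> 0) at_top"
          "((\<lambda>y::real. (1 + \<bar>x\<bar>) * (B / (1 + y\<^sup>2))) \<longlongrightarrow> 0) at_bot"
          by (simp_all only: divide_inverse tendsto_mult_right_zero)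
      qed
      show "(?F \<longlongrightarrow> 0) at_top" "(?F \<longlongrightarrow> 0) at_bot"
        by (rule Lim_null_comparison[OF always_eventually[OF allI[OF bnd]]], rule null)+
    qed
    have "(LBINT y=-\<infinity>..\<infinity>. ?f y) = 0 - 0"
    proof (rule interval_integral_FTC_integrable[where F = ?F])
      show "((?F \<circ> real_of_ereal) \<longlongrightarrow> 0) (at_right (-\<infinity>))" "((?F \<circ> real_of_ereal) \<longlongrightarrow> 0) (at_left \<infinity>)"
        using lim by (simp_all add: ereal_tendsto_simps)
      show "isCont ?f y" for y
        using cont cG by (intro continuous_intros) (auto simp: continuous_on_eq_continuous_at)
      show "set_integrable lborel (einterval (-\<infinity>) \<infinity>) ?f"
        using fi by (simp add: set_integrable_def einterval_def)
      show "(?F has_vector_derivative ?f y) (at y)" for y by (rule d)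
    qed simp
    then have "(LINT y|lborel. ?f y) = 0"
      by (simp add: interval_lebesgue_integral_def einterval_def set_lebesgue_integral_def)
    moreover have "(LINT y|lborel. ?f y) = fourier G2 (- x) + x\<^sup>2 * fourier G (- x)"
      unfolding fourier_def[symmetric, of "\<lambda>y. G2 y + x\<^sup>2 * G y" "- x"]
      using fourier_add[OF iG2 integrable_mult_right[OF iG], of "of_real (x\<^sup>2)" "- x"] by (simp add: fourier_cmult)
    ultimately show ?thesis by (simp add: eq_neg_iff_add_eq_0)
  qed
  define g where "g = (\<lambda>x. fourier G (- x) / (2 * pi))"
  have [measurable]: "g \<in> borel_measurable borel" unfolding g_def by measurable
  have bg: "norm (g x) \<le> B / (1 + x\<^sup>2)" for x
  proof -
    have "norm (fourier G (- x)) \<le> pi * B" using norm_fourier_le[OF iG, of "- x"] nG by simp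
    moreover have "x\<^sup>2 * norm (fourier G (- x)) \<le> pi * B" 
      using norm_fourier_le[OF iG2, of "- x"] nG2 by (simp add: parts norm_mult norm_power)
    ultimately have "(1 + x\<^sup>2) * norm (fourier G (- x)) \<le> 2 * pi * B" by (simp add: algebra_simps)
    then have "(1 + x\<^sup>2) * norm (g x) \<le> B" 
      unfolding g_def by (simp add: norm_divide field_simps)
    then show ?thesis by (simp add: pos_le_divide_eq add_pos_nonneg mult.commute)
  qed
  have g: "integrable lborel g"
    by (rule Bochner_Integration.integrable_bound[OF w(1)]) (use B bg in auto)
  have "norm (G t) \<le> B" for t
    by (rule order_trans[OF b0]) (use B in \<open>simp add: divide_le_eq add_pos_nonneg distrib_left\<close>)
  then have "fourier g y = G y" for y
    by (intro fourier_inversion[OF iG cG _ g_def g])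
  moreover have "(LINT x|lborel. norm (g x)) \<le> pi * B"
    unfolding w(2)[symmetric] by (intro integral_mono w(1) integrable_norm g bg)
  ultimately show ?thesis using g by (intro exI[of _ g] conjI allI)
qed

section \<open>A dense class with smooth decaying Fourier transforms\<close>

text \<open>The weight \<open>(S\<^sup>2 - x\<^sup>2)\<^sup>2\<close> vanishes to second order at \<open>\<plusminus>S\<close>, so cutting off to \<open>[-S, S]\<close> keeps the
function continuously differentiable; the approximation theorem of Weierstrass then produces enough
functions of this form with polynomial \<open>p\<close>.\<close>

definition bump :: "real \<Rightarrow> (real \<Rightarrow> complex) \<Rightarrow> real \<Rightarrow> complex" where
  "bump S p x = indicator {- S..S} x *\<^sub>R ((S\<^sup>2 - x\<^sup>2)\<^sup>2 *\<^sub>R p x)"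

lemma integrable_bump:
  assumes "continuous_on UNIV p" 
  shows "integrable lborel (bump S p)"
  unfolding bump_def[abs_def]
  by (intro borel_integrable_compact continuous_intros continuous_on_subset[OF assms]) auto

text \<open>Two integrations by parts over \<open>[-S, S]\<close>; the boundary terms vanish because \<open>u\<close> and its derivative
do.\<close>

lemma fourier_bump_decay:
  assumes p: "polynomial_function p" and S: "0 < S"
  shows "\<exists>B. \<forall>y. norm (fourier (bump S p) y) \<le> B / (1 + y\<^sup>2)"
proof -
  obtain p1 where p1: "polynomial_function p1" "\<And>x. (p has_vector_derivative p1 x) (at x)"
    using has_vector_derivative_polynomial_function[OF p] by blast
  obtain p2 where p2: "polynomial_function p2" "\<And>x. (p1 has_vector_derivative p2 x) (at x)"
    using has_vector_derivative_polynomial_function[OF p1(1)] by blast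
  have cp: "continuous_on A p" "continuous_on A p1" "continuous_on A p2" for A
    using p p1 p2 by (auto intro: continuous_on_polymonial_function)
  define u where "u x = (S\<^sup>2 - x\<^sup>2)\<^sup>2 *\<^sub>R p x" for x
  define u1 where "u1 x = (S\<^sup>2 - x\<^sup>2)\<^sup>2 *\<^sub>R p1 x + (-4 * x * (S\<^sup>2 - x\<^sup>2)) *\<^sub>R p x" for x
  define u2 where "u2 x = (S\<^sup>2 - x\<^sup>2)\<^sup>2 *\<^sub>R p2 x + (-4 * x * (S\<^sup>2 - x\<^sup>2)) *\<^sub>R p1 x
      + ((-4 * x * (S\<^sup>2 - x\<^sup>2)) *\<^sub>R p1 x + (12 * x\<^sup>2 - 4 * S\<^sup>2) *\<^sub>R p x)" for x
  have u: "(u has_vector_derivative u1 x) (at x)" for x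
    unfolding u_def u1_def
    by (rule has_vector_derivative_scaleR[OF _ p1(2)])
       (auto intro!: derivative_eq_intros simp: algebra_simps power2_eq_square)
  have u1: "(u1 has_vector_derivative u2 x) (at x)" for x
    unfolding u1_def u2_def
    by (intro has_vector_derivative_add has_vector_derivative_scaleR[OF _ p1(2)] has_vector_derivative_scaleR[OF _ p2(2)])
       (auto intro!: derivative_eq_intros simp: algebra_simps power2_eq_square)
  have cu: "continuous_on A u" "continuous_on A u2" for A
    unfolding u_def u2_def by (intro continuous_intros cp)+
  have iu: "integrable lborel (\<lambda>x. indicator {-S..S} x *\<^sub>R u x)" and iu2: "integrable lborel (\<lambda>x. indicator {-S..S} x *\<^sub>R u2 x)"
    using borel_integrable_compact[of "{-S..S}"] cu by (auto simp: set_integrable_def)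
  have bump: "bump S p = (\<lambda>x. indicator {-S..S} x *\<^sub>R u x)"
    by (simp add: bump_def u_def fun_eq_iff)
  define A where "A = (LINT x|lborel. norm (indicator {-S..S} x *\<^sub>R u x))"
  define A2 where "A2 = (LINT x|lborel. norm (indicator {-S..S} x *\<^sub>R u2 x))"
  have "norm (fourier (bump S p) y) \<le> (A + A2) / (1 + y\<^sup>2)" for y
  proof -
    \<comment> \<open>Again both integrations by parts are done at once, with the primitive
\<open>(u' - i y u) exp (i x y)\<close> of \<open>(u'' + y\<^sup>2 u) exp (i x y)\<close>.\<close>
    have z: "has_bochner_integral lborel (\<lambda>x. indicator {-S..S} x *\<^sub>R ((u2 x + y\<^sup>2 * u x) * iexp (x * y)))
        ((u1 S - \<i> * y * u S) * iexp (S * y) - (u1 (-S) - \<i> * y * u (-S)) * iexp (-S * y))"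
    proof (rule has_bochner_integral_FTC_Icc[where F="\<lambda>x. (u1 x - \<i> * y * u x) * iexp (x * y)"])
      fix x
      have "((\<lambda>x. (u1 x - \<i> * y * u x) * iexp (x * y)) has_vector_derivative
        (u1 x - \<i> * y * u x) * (\<i> * y * iexp (y * x)) + (u2 x - \<i> * y * u1 x) * iexp (x * y)) (at x)"
        using has_vector_derivative_iexp_mult[of y x]
        by (intro has_vector_derivative_mult has_vector_derivative_diff has_vector_derivative_mult_right u u1) (simp add: mult.commute)
      then have "((\<lambda>x. (u1 x - \<i> * y * u x) * iexp (x * y)) has_vector_derivative (u2 x + y\<^sup>2 * u x) * iexp (x * y)) (at x)"
        by (rule has_vector_derivative_eq_rhs) (simp add: algebra_simps power2_eq_square)
      then show "((\<lambda>x. (u1 x - \<i> * y * u x) * iexp (x * y)) has_vector_derivative (u2 x + y\<^sup>2 * u x) * iexp (x * y)) (at x within {-S..S})"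
        by (rule has_vector_derivative_at_within)
    next
      show "continuous_on {-S..S} (\<lambda>x. (u2 x + y\<^sup>2 * u x) * iexp (x * y))"
        by (intro continuous_intros cu)
    qed (use S in auto)
    have "(LINT x|lborel. (indicator {-S..S} x *\<^sub>R u2 x + of_real (y\<^sup>2) * (indicator {-S..S} x *\<^sub>R u x)) * iexp (x * y)) = 0"
    proof -
      have "(indicator {-S..S} x *\<^sub>R u2 x + of_real (y\<^sup>2) * (indicator {-S..S} x *\<^sub>R u x)) * iexp (x * y)
        = indicator {-S..S} x *\<^sub>R ((u2 x + y\<^sup>2 * u x) * iexp (x * y))" for x
        by (simp add: indicator_def)
      moreover have "u S = 0" "u (-S) = 0" "u1 S = 0" "u1 (-S) = 0" by (auto simp: u_def u1_def)
      ultimately show ?thesis using has_bochner_integral_integral_eq[OF z] by simp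
    qed
    then have "fourier (\<lambda>x. indicator {-S..S} x *\<^sub>R u2 x) y + of_real (y\<^sup>2) * fourier (bump S p) y = 0"
      using fourier_add[OF iu2 integrable_mult_right[OF iu], of "of_real (y\<^sup>2)" y]
      unfolding bump fourier_cmult by (simp only: fourier_def)
    then have "of_real (y\<^sup>2) * fourier (bump S p) y = - fourier (\<lambda>x. indicator {-S..S} x *\<^sub>R u2 x) y"
      by (simp only: eq_neg_iff_add_eq_0 add.commute)
    then have "y\<^sup>2 * norm (fourier (bump S p) y) = norm (fourier (\<lambda>x. indicator {-S..S} x *\<^sub>R u2 x) y)"
      by (metis norm_minus_cancel norm_mult norm_of_real abs_power2)
    then have "y\<^sup>2 * norm (fourier (bump S p) y) \<le> A2"
      using norm_fourier_le[OF iu2, of y] by (simp add: A2_def)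
    moreover have "norm (fourier (bump S p) y) \<le> A"
      using norm_fourier_le[OF iu, of y] by (simp add: A_def bump)
    ultimately have "(1 + y\<^sup>2) * norm (fourier (bump S p) y) \<le> A + A2" by (simp add: algebra_simps)
    then show ?thesis by (simp add: pos_le_divide_eq add_pos_nonneg mult.commute)
  qed
  then show ?thesis by blast
qed

text \<open>The hypotheses of \<open>fourier_of_decaying\<close>. When \<open>1 + K\<close> is bounded away from \<open>0\<close>, they pass from \<open>K\<close> to
\<open>1 / (1 + K)^n - 1\<close>.\<close>

definition decaying_C2 :: "(real \<Rightarrow> complex) \<Rightarrow> bool" where
 "decaying_C2 K \<longleftrightarrow> (\<exists>K1 K2 B. (\<forall>y. (K has_vector_derivative K1 y) (at y)) \<and> (\<forall>y. (K1 has_vector_derivative K2 y) (at y)) \<and>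
    continuous_on UNIV K2 \<and> (\<forall>y. norm (K y) \<le> B / (1 + y\<^sup>2) \<and> norm (K1 y) \<le> B / (1 + y\<^sup>2) \<and> norm (K2 y) \<le> B / (1 + y\<^sup>2)))"

text \<open>Differentiating the transform multiplies the polynomial by \<open>i x\<close>, so the derivatives are
transforms of functions of the same form and decay for the same reason.\<close>

lemma decaying_C2_fourier_bump:
  assumes p: "polynomial_function p" and S: "0 < S"
  shows "decaying_C2 (fourier (bump S p))"
proof -
  define q where "q x = x *\<^sub>R (\<i> * p x)" for x
  define r where "r x = x *\<^sub>R (\<i> * q x)" for x
  have i: "polynomial_function (\<lambda>x. \<i> * f x)" if "polynomial_function f" for f :: "real \<Rightarrow> complex"
    using polynomial_function_compose[OF that polynomial_function_bounded_linear[OF bounded_linear_mult_right]]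
    by (simp add: o_def)
  have q: "polynomial_function q" and r: "polynomial_function r"
  proof -
    show q: "polynomial_function q"
      unfolding q_def[abs_def] by (intro polynomial_function_mult i polynomial_function_id p)
    show "polynomial_function r"
      unfolding r_def[abs_def] by (intro polynomial_function_mult i polynomial_function_id q)
  qed
  have int: "integrable lborel (bump S f)" if "polynomial_function f" for f
    using continuous_on_polymonial_function[OF that] by (intro integrable_bump) 
  have bq: "bump S q = (\<lambda>x. \<i> * x * bump S p x)" and br: "bump S r = (\<lambda>x. \<i> * x * bump S q x)"
    by (auto simp: bump_def q_def r_def fun_eq_iff scaleR_conv_of_real algebra_simps)
  obtain A B C where A: "\<And>y. norm (fourier (bump S p) y) \<le> A / (1 + y\<^sup>2)" and
    B: "\<And>y. norm (fourier (bump S q) y) \<le> B / (1 + y\<^sup>2)" and C: "\<And>y. norm (fourier (bump S r) y) \<le> C / (1 + y\<^sup>2)"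
    using fourier_bump_decay[OF p S] fourier_bump_decay[OF q S] fourier_bump_decay[OF r S] by blast
  let ?M = "max A (max B C)"
  have le: "x / (1 + y\<^sup>2) \<le> ?M / (1 + y\<^sup>2)" if "x \<le> ?M" for x y :: real
    using that by (intro divide_right_mono) (auto simp: add_nonneg_nonneg)
  have M: "norm (fourier (bump S p) y) \<le> ?M / (1 + y\<^sup>2) \<and> norm (fourier (bump S q) y) \<le> ?M / (1 + y\<^sup>2)
      \<and> norm (fourier (bump S r) y) \<le> ?M / (1 + y\<^sup>2)" for y
    by (intro conjI order_trans[OF A le] order_trans[OF B le] order_trans[OF C le]) auto
  show ?thesis
    unfolding decaying_C2_def
  proof (intro exI conjI allI)
    show "(fourier (bump S p) has_vector_derivative fourier (bump S q) y) (at y)" for y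
      unfolding bq using int[OF p] int[OF q] by (intro has_vector_derivative_fourier) (auto simp: bq)
    show "(fourier (bump S q) has_vector_derivative fourier (bump S r) y) (at y)" for y
      unfolding br using int[OF q] int[OF r] by (intro has_vector_derivative_fourier) (auto simp: br)
    show "continuous_on UNIV (fourier (bump S r))"
      by (rule continuous_fourier[OF int[OF r]])
  qed (use M in blast)+
qed

lemma bounded_L1_approx:
  fixes k :: "real \<Rightarrow> complex"
  assumes k: "integrable lborel k" and e: "0 < e"
  obtains M k' where "0 < M" "integrable lborel k'" "\<And>x. norm (k' x) \<le> M" "\<And>x. M < \<bar>x\<bar> \<Longrightarrow> k' x = 0"
    "(LINT x|lborel. norm (k x - k' x)) < e"
proof -
  have [measurable]: "k \<in> borel_measurable borel" using k by auto
  define t where "t n x = (if \<bar>x\<bar> \<le> real (Suc n) \<and> norm (k x) \<le> real (Suc n) then k x else 0)" for n x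
  have [measurable]: "t n \<in> borel_measurable borel" for n unfolding t_def[abs_def] by measurable
  have "(\<lambda>n. LINT x|lborel. norm (k x - t n x)) \<longlonglongrightarrow> (LINT x::real|lborel. (0::real))"
  proof (rule integral_dominated_convergence[where w="\<lambda>x. norm (k x)"])
    show "AE x in lborel. (\<lambda>n. norm (k x - t n x)) \<longlonglongrightarrow> 0"
    proof (rule AE_I2, rule tendsto_eventually)
      fix x
      obtain N where N: "max \<bar>x\<bar> (norm (k x)) \<le> real N" using real_arch_simple by blast
      show "\<forall>\<^sub>F n in sequentially. norm (k x - t n x) = 0"
        using eventually_ge_at_top[of N] by eventually_elim (use N in \<open>auto simp: t_def\<close>)
    qed
  qed (use k in \<open>auto simp: t_def\<close>)
  then have "\<forall>\<^sub>F n in sequentially. (LINT x|lborel. norm (k x - t n x)) < e"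
    using e by (intro order_tendstoD(2)[where a=e and y=0] ) auto
  then obtain n where n: "(LINT x|lborel. norm (k x - t n x)) < e"
    by (auto simp: eventually_sequentially)
  show ?thesis
  proof (rule that[of "real (Suc n)" "t n"])
    show "integrable lborel (t n)"
      by (rule Bochner_Integration.integrable_bound[OF k]) (auto simp: t_def)
  qed (use n in \<open>auto simp: t_def\<close>)
qed

text \<open>First replace \<open>k\<close> by a bounded function \<open>k1\<close> with support in \<open>[-M, M]\<close>. Divided by the weight it is
still bounded, hence an almost everywhere limit of continuous functions, which may be taken bounded
and then be replaced by polynomials that are uniformly close on \<open>[-S, S]\<close>. Multiplying by the
weight again gives convergence to \<open>k1\<close> in \<open>L\<^sub>1\<close> by dominated convergence.\<close>

lemma decaying_C2_dense:
  fixes k :: "real \<Rightarrow> complex"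
  assumes k: "integrable lborel k" and e: "0 < e"
  obtains k' where "integrable lborel k'" "decaying_C2 (fourier k')" "(LINT x|lborel. norm (k x - k' x)) < e"
proof -
  obtain M k1 where M: "0 < M" and k1: "integrable lborel k1" and kM: "\<And>x. norm (k1 x) \<le> M"
    and supp: "\<And>x. M < \<bar>x\<bar> \<Longrightarrow> k1 x = 0" and d1: "(LINT x|lborel. norm (k x - k1 x)) < e / 2"
    using bounded_L1_approx[OF k, of "e / 2"] e by auto
  have [measurable]: "k1 \<in> borel_measurable borel" using k1 by auto
  \<comment> \<open>With this choice the weight is at least \<open>1\<close> on the support of \<open>k1\<close>.\<close>
  define S where "S = M + 1"
  define q where "q x = k1 x /\<^sub>R (S\<^sup>2 - x\<^sup>2)\<^sup>2" for x
  have w1: "1 \<le> (S\<^sup>2 - x\<^sup>2)\<^sup>2" if "\<bar>x\<bar> \<le> M" for x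
  proof -
    have "x\<^sup>2 \<le> M\<^sup>2" using that by (metis abs_le_square_iff abs_of_pos M)
    then have "1 \<le> S\<^sup>2 - x\<^sup>2" using M by (simp add: S_def power2_eq_square algebra_simps)
    then show ?thesis by (simp add: one_le_power)
  qed
  have qM: "norm (q x) \<le> M" for x
  proof (cases "\<bar>x\<bar> \<le> M")
    case True
    have "norm (q x) = norm (k1 x) / (S\<^sup>2 - x\<^sup>2)\<^sup>2" by (simp add: q_def divide_inverse mult.commute)
    also have "\<dots> \<le> norm (k1 x) / 1" by (intro divide_left_mono w1 True) (use w1[OF True] in auto)
    finally show ?thesis using kM[of x] by simp
  qed (use supp M in \<open>simp add: q_def\<close>)
  have qk: "(S\<^sup>2 - x\<^sup>2)\<^sup>2 *\<^sub>R q x = k1 x" for x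
  proof (cases "\<bar>x\<bar> \<le> M")
    case True
    then have "(S\<^sup>2 - x\<^sup>2)\<^sup>2 \<noteq> 0" using w1[OF True] by linarith
    then show ?thesis by (simp add: q_def del: power_eq_0_iff)
  qed (use supp[of x] in \<open>auto simp: q_def\<close>)
  have "q \<in> borel_measurable lborel" unfolding q_def[abs_def] by measurable
  then have "q \<in> borel_measurable lebesgue" by (rule measurable_completion)
  then obtain N g where N: "negligible N" and g: "\<And>n. continuous_on UNIV (g n)"
    and gq: "\<And>x. x \<notin> N \<Longrightarrow> (\<lambda>n. g n x) \<longlonglongrightarrow> q x"
    using lebesgue_measurable_imp_measurable_on[of q UNIV] unfolding measurable_on_def by auto
  \<comment> \<open>Projecting to the ball of radius \<open>M\<close> makes the approximations bounded and fixes the limit.\<close>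
  define c where "c = closest_point (cball (0::complex) M)"
  have c1: "continuous_on A c" for A
    unfolding c_def using M by (intro continuous_on_closest_point) auto
  have c2: "c z \<in> cball 0 M" for z
    unfolding c_def by (rule closest_point_in_set) (use M in auto)
  note c = c1 c2
  have cq: "c (q x) = q x" for x unfolding c_def using qM[of x] by (intro closest_point_self) simp
  have "\<exists>p. polynomial_function p \<and> (\<forall>x\<in>{-S..S}. norm (c (g n x) - p x) < 1 / Suc n)" for n
    using g c(1) by (intro Stone_Weierstrass_polynomial_function continuous_on_compose2[OF c(1)[of UNIV]] 
        continuous_on_subset[OF g]) auto
  then obtain p where p: "\<And>n. polynomial_function (p n)"
    and cp: "\<And>n x. x \<in> {-S..S} \<Longrightarrow> norm (c (g n x) - p n x) < 1 / Suc n" by metis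
  have int: "integrable lborel (bump S (p n))" for n
    using continuous_on_polymonial_function[OF p] by (intro integrable_bump)
  have [measurable]: "bump S (p n) \<in> borel_measurable borel" for n using int[of n] by auto
  have pM: "norm (p n x) \<le> M + 1" if "x \<in> {-S..S}" for n x
  proof -
    have "1 / real (Suc n) \<le> 1" by simp
    moreover have "norm (p n x) \<le> norm (c (g n x)) + norm (c (g n x) - p n x)"
      using norm_triangle_ineq4[of "c (g n x)" "c (g n x) - p n x"] by simp
    ultimately show ?thesis using cp[OF that, of n] c(2)[of "g n x"] by (simp only: mem_cball_0)
  qed
  let ?dom = "\<lambda>x. norm (k1 x) + indicator {-S..S} x * (S ^ 4 * (M + 1))"
  have "(\<lambda>n. LINT x|lborel. norm (k1 x - bump S (p n) x)) \<longlonglongrightarrow> (LINT x::real|lborel. (0::real))"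
  proof (rule integral_dominated_convergence[where w="?dom"])
    from negligible_AE_lborel[OF N] show "AE x in lborel. (\<lambda>n. norm (k1 x - bump S (p n) x)) \<longlonglongrightarrow> 0"
    proof eventually_elim
      case (elim x)
      show ?case
      proof (cases "x \<in> {-S..S}")
        case True
        have "isCont c (q x)" using c(1)[of UNIV] by (simp add: continuous_on_eq_continuous_at)
        then have cg: "(\<lambda>n. c (g n x)) \<longlonglongrightarrow> q x"
          using isCont_tendsto_compose[OF _ gq[OF elim]] cq by metis
        have "(\<lambda>n. c (g n x) - p n x) \<longlonglongrightarrow> 0"
          by (rule Lim_null_comparison[OF _ lim_inverse_n'[THEN LIMSEQ_Suc]])
             (use cp[OF True] in \<open>auto intro!: always_eventually less_imp_le\<close>)
        from tendsto_diff[OF cg this] have "(\<lambda>n. p n x) \<longlonglongrightarrow> q x" by simp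
        then have "(\<lambda>n. norm (k1 x - (S\<^sup>2 - x\<^sup>2)\<^sup>2 *\<^sub>R p n x)) \<longlonglongrightarrow> norm (k1 x - (S\<^sup>2 - x\<^sup>2)\<^sup>2 *\<^sub>R q x)"
          by (intro tendsto_intros)
        then show ?thesis using True by (simp add: qk bump_def)
      qed (use supp[of x] M in \<open>auto simp: bump_def S_def\<close>)
    qed
    show "integrable lborel ?dom"
      using k1 borel_integrable_compact[of "{-S..S}" "\<lambda>_. S ^ 4 * (M + 1)"]
      by (intro Bochner_Integration.integrable_add) auto
    fix n
    show "AE x in lborel. norm (norm (k1 x - bump S (p n) x)) \<le> ?dom x"
    proof (rule AE_I2)
      fix x
      have "norm (bump S (p n) x) \<le> indicator {-S..S} x * (S ^ 4 * (M + 1))"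
      proof (cases "x \<in> {-S..S}")
        case True
        then have "x\<^sup>2 \<le> S\<^sup>2" by (simp add: abs_le_square_iff[symmetric] abs_le_iff)
        then have "(S\<^sup>2 - x\<^sup>2)\<^sup>2 \<le> (S\<^sup>2)\<^sup>2" by (intro power_mono) auto
        then have "(S\<^sup>2 - x\<^sup>2)\<^sup>2 * norm (p n x) \<le> S ^ 4 * (M + 1)"
          using pM[OF True, of n] M by (intro mult_mono) (auto simp: power_mult[symmetric])
        then show ?thesis using True by (simp add: bump_def)
      qed (simp add: bump_def)
      then show "norm (norm (k1 x - bump S (p n) x)) \<le> ?dom x"
        using norm_triangle_ineq4[of "k1 x" "bump S (p n) x"] by simp
    qed
  qed auto
  then have "\<forall>\<^sub>F n in sequentially. (LINT x|lborel. norm (k1 x - bump S (p n) x)) < e / 2"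
    using e by (intro order_tendstoD(2)[where a="e / 2" and y=0] ) auto
  then obtain n where n: "(LINT x|lborel. norm (k1 x - bump S (p n) x)) < e / 2"
    by (auto simp: eventually_sequentially)
  have "(LINT x|lborel. norm (k x - bump S (p n) x))
      \<le> (LINT x|lborel. norm (k x - k1 x) + norm (k1 x - bump S (p n) x))"
    using k k1 int norm_triangle_ineq[of "k x - k1 x" "k1 x - bump S (p n) x" for x]
    by (intro integral_mono) auto
  also have "\<dots> < e" using d1 n k k1 int by (subst Bochner_Integration.integral_add) auto
  finally show ?thesis
    using that[OF int decaying_C2_fourier_bump[OF p]] M by (simp add: S_def)
qed

section \<open>Wiener's inversion theorem on the line\<close>

text \<open>\<open>G\<close> lies in the ball of radius \<open>c\<close> of the Fourier algebra, the algebra of transforms of integrable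
functions normed by \<open>L\<^sub>1\<close>. Working with transforms replaces convolution powers by powers.\<close>

definition fourier_ball :: "(real \<Rightarrow> complex) \<Rightarrow> real \<Rightarrow> bool" where
  "fourier_ball G c \<longleftrightarrow> (\<exists>g. integrable lborel g \<and> (\<forall>y. fourier g y = G y) \<and> (LINT x|lborel. norm (g x)) \<le> c)"

lemma fourier_ball_add: "fourier_ball F a \<Longrightarrow> fourier_ball G b \<Longrightarrow> fourier_ball (\<lambda>y. F y + G y) (a + b)"
proof -
  assume "fourier_ball F a" "fourier_ball G b"
  then obtain f g where f: "integrable lborel f" "\<And>y. fourier f y = F y" "(LINT x|lborel. norm (f x)) \<le> a"
    and g: "integrable lborel g" "\<And>y. fourier g y = G y" "(LINT x|lborel. norm (g x)) \<le> b"
    unfolding fourier_ball_def by blast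
  have "(LINT x|lborel. norm (f x + g x)) \<le> (LINT x|lborel. norm (f x) + norm (g x))"
    using f(1) g(1) by (intro integral_mono norm_triangle_ineq) auto
  also have "\<dots> \<le> a + b" using f g by simp
  finally show ?thesis
    unfolding fourier_ball_def using f g by (intro exI[of _ "\<lambda>x. f x + g x"]) (simp add: fourier_add)
qed

lemma fourier_ball_mult: "fourier_ball F a \<Longrightarrow> fourier_ball G b \<Longrightarrow> fourier_ball (\<lambda>y. F y * G y) (a * b)"
proof -
  assume "fourier_ball F a" "fourier_ball G b"
  then obtain f g where f: "integrable lborel f" "\<And>y. fourier f y = F y" "(LINT x|lborel. norm (f x)) \<le> a"
    and g: "integrable lborel g" "\<And>y. fourier g y = G y" "(LINT x|lborel. norm (g x)) \<le> b"
    unfolding fourier_ball_def by blast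
  have "(LINT x|lborel. norm (f x)) * (LINT x|lborel. norm (g x)) \<le> a * b"
    by (intro mult_mono f g Bochner_Integration.integral_nonneg order_trans[OF Bochner_Integration.integral_nonneg f(3)]) auto
  then have "(LINT x|lborel. norm (signed_conv 1 (-1) f g x)) \<le> a * b"
    using norm_signed_conv_le[of 1 f g "-1"] f g by simp
  then show ?thesis
    unfolding fourier_ball_def using f g
    by (intro exI[of _ "signed_conv 1 (-1) f g"]) (simp add: fourier_signed_conv integrable_signed_conv)
qed

lemma fourier_ball_uminus: "fourier_ball G c \<Longrightarrow> fourier_ball (\<lambda>y. - G y) c"
proof -
  assume "fourier_ball G c"
  then obtain g where g: "integrable lborel g" "\<And>y. fourier g y = G y" "(LINT x|lborel. norm (g x)) \<le> c"
    unfolding fourier_ball_def by blast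
  then show ?thesis
    unfolding fourier_ball_def using fourier_cmult[of "-1" g] 
    by (intro exI[of _ "\<lambda>x. -1 * g x"]) simp
qed

lemma fourier_ball_power_mult:
  assumes "fourier_ball R r" "fourier_ball G c"
  shows "fourier_ball (\<lambda>y. R y ^ n * G y) (r ^ n * c)"
proof (induction n)
  case (Suc n)
  from fourier_ball_mult[OF assms(1) Suc] show ?case by (simp add: mult.assoc)
qed (use assms in simp)

lemma AE_summable_norm:
  fixes g :: "nat \<Rightarrow> 'a \<Rightarrow> 'b::{banach, second_countable_topology}"
  assumes g: "\<And>n. integrable M (g n)" and s: "summable (\<lambda>n. LINT x|M. norm (g n x))"
  shows "AE x in M. summable (\<lambda>n. norm (g n x))"
proof -
  have [measurable]: "g n \<in> borel_measurable M" for n using g by auto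
  have "(\<integral>\<^sup>+x. (\<Sum>n. ennreal (norm (g n x))) \<partial>M) = (\<Sum>n. \<integral>\<^sup>+x. ennreal (norm (g n x)) \<partial>M)"
    by (intro nn_integral_suminf) simp
  also have "\<dots> = (\<Sum>n. ennreal (LINT x|M. norm (g n x)))"
    using g by (simp add: nn_integral_eq_integral)
  also have "\<dots> < \<infinity>" using s by (simp add: suminf_ennreal_eq[OF _ summable_sums])
  finally have "(\<integral>\<^sup>+x. (\<Sum>n. ennreal (norm (g n x))) \<partial>M) \<noteq> \<infinity>" by simp
  then have "AE x in M. (\<Sum>n. ennreal (norm (g n x))) \<noteq> \<infinity>"
    by (intro nn_integral_PInf_AE) auto
  then show ?thesis
    by eventually_elim (auto intro: summable_suminf_not_top)
qed

text \<open>Completeness of the Fourier algebra: the series of representing functions converges absolutely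
almost everywhere and in \<open>L\<^sub>1\<close>.\<close>

lemma fourier_ball_suminf:
  assumes G: "\<And>n. fourier_ball (G n) (c n)" and c: "summable c"
  shows "fourier_ball (\<lambda>y. \<Sum>n. G n y) (\<Sum>n. c n)"
proof -
  obtain g where g: "\<And>n. integrable lborel (g n)" and f: "\<And>n y. fourier (g n) y = G n y"
    and gc: "\<And>n. (LINT x|lborel. norm (g n x)) \<le> c n"
    using G unfolding fourier_ball_def by metis
  have s: "summable (\<lambda>n. LINT x|lborel. norm (g n x))"
    by (rule summable_comparison_test'[OF c, of 0]) (simp add: gc)
  have AE: "AE x in lborel. summable (\<lambda>n. norm (g n x))" by (rule AE_summable_norm[OF g s])
  define h where "h x = (\<Sum>n. g n x)" for x
  have h: "integrable lborel h" unfolding h_def[abs_def] by (rule integrable_suminf[OF g AE s])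
  have "fourier h y = (\<Sum>n. G n y)" for y
  proof -
    have "fourier h y = (LINT x|lborel. (\<Sum>n. g n x * iexp (x * y)))"
      unfolding fourier_def
    proof (rule integral_cong_AE)
      show "AE x in lborel. h x * iexp (x * y) = (\<Sum>n. g n x * iexp (x * y))"
        using AE by eventually_elim (auto simp: h_def intro!: suminf_mult2 summable_norm_cancel)
    qed (use g h in \<open>auto intro!: borel_measurable_suminf borel_measurable_times\<close>)
    also have "\<dots> = (\<Sum>n. LINT x|lborel. g n x * iexp (x * y))"
      by (rule integral_suminf) (use g AE s in \<open>auto simp: integrable_mult_iexp norm_mult simp del: of_real_mult\<close>)
    finally show ?thesis by (simp add: f[symmetric] fourier_def)
  qed
  moreover have "(LINT x|lborel. norm (h x)) \<le> (\<Sum>n. c n)"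
  proof -
    have "(LINT x|lborel. norm (h x)) \<le> (LINT x|lborel. (\<Sum>n. norm (g n x)))"
    proof (rule integral_mono_AE)
      show "integrable lborel (\<lambda>x. \<Sum>n. norm (g n x))"
        by (rule integrable_suminf) (use g AE s in auto)
      show "AE x in lborel. norm (h x) \<le> (\<Sum>n. norm (g n x))"
        using AE by eventually_elim (simp add: h_def summable_norm)
    qed (use h in simp)
    also have "\<dots> = (\<Sum>n. LINT x|lborel. norm (g n x))"
      by (rule integral_suminf) (use g AE s in auto)
    also have "\<dots> \<le> (\<Sum>n. c n)" by (intro suminf_le gc s c)
    finally show ?thesis .
  qed
  ultimately show ?thesis unfolding fourier_ball_def using h by blast
qed

text \<open>The key estimate: up to a factor quadratic in \<open>n\<close>, the norm grows no faster than the sup norm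
\<open>1 / m^n\<close>. Differentiating \<open>(1 + K)^-(n + 1)\<close> twice only costs the factor \<open>(n + 1) (n + 2)\<close> and two
more powers of \<open>1 / m\<close>.\<close>

lemma fourier_ball_inverse_power:
  assumes d1: "\<And>y. (K has_vector_derivative K1 y) (at y)" and d2: "\<And>y. (K1 has_vector_derivative K2 y) (at y)"
    and cont: "continuous_on UNIV K2"
    and b: "\<And>y. norm (K y) \<le> B / (1 + y\<^sup>2)" "\<And>y. norm (K1 y) \<le> B / (1 + y\<^sup>2)" "\<And>y. norm (K2 y) \<le> B / (1 + y\<^sup>2)"
    and B: "1 \<le> B" and m: "0 < m" "m \<le> 1" and low: "\<And>y. m \<le> norm (1 + K y)"
  shows "fourier_ball (\<lambda>y. inverse (1 + K y) ^ Suc n - 1) (pi * (2 * B\<^sup>2 * (real (n + 1) * real (n + 2)) / m ^ (n + 3)))"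
proof -
  define Q where "Q y = inverse (1 + K y)" for y
  have P0: "1 + K y \<noteq> 0" for y using low[of y] m by auto
  have Q0: "norm (Q y) \<le> 1 / m" for y
    using le_imp_inverse_le[OF low[of y] m(1)] unfolding Q_def norm_inverse by (simp only: inverse_eq_divide)
  have qpow: "norm (Q y ^ j) \<le> 1 / m ^ j" for y j
    using power_mono[OF Q0[of y], of j] by (simp add: norm_power power_divide)
  have m1: "1 / m ^ i \<le> 1 / m ^ j" if "i \<le> j" for i j
    using m that by (intro divide_left_mono power_decreasing) auto
  define N where "N = real (n + 1)"
  have N: "1 \<le> N" "real (n + 2) = N + 1" by (auto simp: N_def)
  define G1 where "G1 y = - (N * Q y ^ (n + 2) * K1 y)" for y
  define G2 where "G2 y = N * ((N + 1) * Q y ^ (n + 3) * (K1 y)\<^sup>2) - N * Q y ^ (n + 2) * K2 y" for y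
  define D where "D = 2 * B\<^sup>2 * (N * (N + 1)) / m ^ (n + 3)"
  have d: "0 < 1 / (1 + y\<^sup>2)" "1 / (1 + y\<^sup>2) \<le> 1" for y :: real
    by (auto simp: add_pos_nonneg divide_le_eq_1)
  have BB: "B \<le> B\<^sup>2" using B by (simp add: power2_eq_square)
  have dQ: "((\<lambda>y. Q y ^ Suc j) has_vector_derivative - (real (Suc j) * Q y ^ (j + 2) * K1 y)) (at y)" for j y
  proof -
    have "((\<lambda>z. inverse (1 + z) ^ Suc j) has_field_derivative - (of_nat (Suc j) * inverse (1 + K y) ^ (j + 2))) (at (K y))"
      by (rule derivative_eq_intros refl | use P0 in simp)+ 
    from field_vector_diff_chain_at[OF d1 this] show ?thesis
      by (simp add: o_def Q_def mult_ac)
  qed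
  have "fourier_ball (\<lambda>y. Q y ^ Suc n - 1) (pi * D)"
    unfolding fourier_ball_def
  proof (rule fourier_of_decaying)
    show "((\<lambda>y. Q y ^ Suc n - 1) has_vector_derivative G1 y) (at y)" for y
      using has_vector_derivative_diff[OF dQ[of n y] has_vector_derivative_const[of 1]]
      by (simp add: G1_def N_def)
    show "(G1 has_vector_derivative G2 y) (at y)" for y
    proof -
      have "((\<lambda>y. - (N * (Q y ^ Suc (n + 1) * K1 y))) has_vector_derivative
         - (N * (Q y ^ Suc (n + 1) * K2 y + (- (real (Suc (n + 1)) * Q y ^ (n + 1 + 2) * K1 y)) * K1 y))) (at y)"
        by (intro has_vector_derivative_minus has_vector_derivative_mult_right has_vector_derivative_mult dQ d2)
      moreover have "(\<lambda>y. - (N * (Q y ^ Suc (n + 1) * K1 y))) = G1"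
        by (simp add: G1_def fun_eq_iff)
      moreover have "- (N * (Q y ^ Suc (n + 1) * K2 y + (- (real (Suc (n + 1)) * Q y ^ (n + 1 + 2) * K1 y)) * K1 y)) = G2 y"
        by (simp add: G2_def N_def numeral_3_eq_3 algebra_simps power2_eq_square)
      ultimately show ?thesis by (simp only:)
    qed
    have cK: "continuous_on UNIV K" "continuous_on UNIV K1" 
      using d1 d2 by (meson continuous_at_imp_continuous_on has_vector_derivative_continuous)+
    show "continuous_on UNIV G2"
      unfolding G2_def[abs_def] Q_def[abs_def] by (intro continuous_intros cK cont) (use P0 in auto)
    fix y :: real
    let ?d = "1 / (1 + y\<^sup>2)"
    have Kd: "norm (K y) \<le> B * ?d" "norm (K1 y) \<le> B * ?d" "norm (K2 y) \<le> B * ?d" using b[of y] by simp_all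
    define E where "E = B\<^sup>2 * (N * (N + 1)) * (1 / m ^ (n + 3)) * ?d"
    have DE: "D / (1 + y\<^sup>2) = 2 * E"
      by (simp add: D_def E_def)
    have key: "N * (1 / m ^ i) * (B * ?d) \<le> E" if "i \<le> n + 3" for i
    proof -
      have "N * (1 / m ^ i) * (B * ?d) = B * N * (1 / m ^ i) * ?d" by simp
      also have "\<dots> \<le> E"
        unfolding E_def using N m B d[of y] BB by (intro mult_right_mono mult_mono m1 that) auto
      finally show ?thesis .
    qed
    have nn: "0 \<le> E"
      unfolding E_def using N m d[of y] by simp
    show "norm (Q y ^ Suc n - 1) \<le> D / (1 + y\<^sup>2)"
    proof -
      \<comment> \<open>Scaling by \<open>m\<close> brings both bases into the unit disc, where \<open>z \<mapsto> z ^ (n + 1)\<close> has Lipschitz constant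
\<open>n + 1\<close>.\<close>
      have "norm ((m * Q y) ^ Suc n - of_real m ^ Suc n) \<le> real (Suc n) * norm (m * Q y - m)"
        using Q0[of y] m by (intro norm_power_diff) (auto simp: norm_mult field_simps)
      also have "m * Q y - m = - (m * Q y * K y)" using P0[of y] by (simp add: Q_def field_simps)
      also have "norm (- (m * Q y * K y)) \<le> 1 * norm (K y)"
        unfolding norm_minus_cancel norm_mult[of "m * Q y"] using Q0[of y] m
        by (intro mult_right_mono) (auto simp: norm_mult field_simps)
      also have "(m * Q y) ^ Suc n - of_real m ^ Suc n = of_real m ^ Suc n * (Q y ^ Suc n - 1)"
        by (simp add: power_mult_distrib right_diff_distrib)
      finally have "m ^ Suc n * norm (Q y ^ Suc n - 1) \<le> N * norm (K y)"
        using m by (simp add: norm_mult norm_power N_def mult_left_mono)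
      then have "norm (Q y ^ Suc n - 1) \<le> N * (1 / m ^ Suc n) * norm (K y)"
        using m by (simp add: field_simps)
      also have "\<dots> \<le> N * (1 / m ^ Suc n) * (B * ?d)"
        using N m by (intro mult_left_mono Kd) auto
      finally show ?thesis using key[of "Suc n"] nn unfolding DE by linarith
    qed
    have G1b: "norm (N * Q y ^ (n + 2) * z) \<le> N * (1 / m ^ (n + 2)) * (B * ?d)" if "norm z \<le> B * ?d" for z :: complex
      unfolding norm_mult using N m by (intro mult_mono qpow that) auto
    show "norm (G1 y) \<le> D / (1 + y\<^sup>2)"
      using order_trans[OF G1b[OF Kd(2)] key[of "n + 2"]] nn unfolding DE G1_def norm_minus_cancel by linarith
    show "norm (G2 y) \<le> D / (1 + y\<^sup>2)"
    proof -
      have "(norm (K1 y))\<^sup>2 \<le> (B * ?d)\<^sup>2" using Kd(2) by (intro power_mono) auto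
      also have "\<dots> \<le> B\<^sup>2 * ?d" 
        unfolding power_mult_distrib using mult_left_le[of ?d ?d] d[of y]
        by (intro mult_left_mono) (simp_all only: power2_eq_square zero_le_square)
      finally have K2: "(norm (K1 y))\<^sup>2 \<le> B\<^sup>2 * ?d" .
      have "norm (N * ((N + 1) * Q y ^ (n + 3) * (K1 y)\<^sup>2)) = N * ((N + 1) * norm (Q y ^ (n + 3)) * (norm (K1 y))\<^sup>2)"
        using N by (simp add: norm_mult norm_power)
      also have "\<dots> \<le> N * ((N + 1) * (1 / m ^ (n + 3)) * (B\<^sup>2 * ?d))"
        using N m qpow K2 by (intro mult_left_mono mult_mono) auto
      also have "\<dots> = E" by (simp only: E_def mult_ac)
      finally have "norm (N * ((N + 1) * Q y ^ (n + 3) * (K1 y)\<^sup>2)) \<le> E" .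
      moreover have "norm (N * Q y ^ (n + 2) * K2 y) \<le> E"
        by (rule order_trans[OF G1b[OF Kd(3)] key]) simp
      ultimately show ?thesis
        unfolding G2_def DE by (intro order_trans[OF norm_triangle_ineq4]) linarith
    qed
  qed
  then show ?thesis by (simp add: Q_def D_def N_def add.commute)
qed

text \<open>Away from a compact interval the transform is small, because it is uniformly close to a decaying
one (the Riemann--Lebesgue lemma); on the interval continuity and compactness apply.\<close>

lemma fourier_bounded_below:
  assumes k: "integrable lborel k" and nz: "\<And>y. 1 + fourier k y \<noteq> 0"
  obtains d where "0 < d" "d \<le> 1" "\<And>y. d \<le> norm (1 + fourier k y)"
proof -
  obtain k' where k': "integrable lborel k'" "decaying_C2 (fourier k')" and d: "(LINT x|lborel. norm (k x - k' x)) < 1 / 4"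
    using decaying_C2_dense[OF k, of "1 / 4"] by auto
  obtain B where B: "\<And>y. norm (fourier k' y) \<le> B / (1 + y\<^sup>2)"
    using k'(2) unfolding decaying_C2_def by blast
  have near: "norm (fourier k y - fourier k' y) < 1 / 4" for y
    using norm_fourier_le[of "\<lambda>x. k x - k' x" y] d k k' by (simp add: fourier_diff)
  have far: "1 / 2 \<le> norm (1 + fourier k y)" if y: "4 * B \<le> 1 + y\<^sup>2" for y
  proof -
    have "B / (1 + y\<^sup>2) \<le> 1 / 4" using y by (simp add: divide_le_eq add_pos_nonneg)
    then have "norm (fourier k' y) \<le> 1 / 4" using B[of y] by linarith
    then have "norm (fourier k y) \<le> 1 / 2"
      using near[of y] norm_triangle_ineq[of "fourier k y - fourier k' y" "fourier k' y"] by simp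
    then show ?thesis using norm_triangle_ineq4[of "1 + fourier k y" "fourier k y"] by simp
  qed
  define Y where "Y = max 1 (4 * B)"
  have "\<exists>y0\<in>{-Y..Y}. \<forall>y\<in>{-Y..Y}. norm (1 + fourier k y0) \<le> norm (1 + fourier k y)"
    by (intro continuous_attains_inf) (auto simp: Y_def intro!: continuous_intros continuous_on_subset[OF continuous_fourier[OF k]])
  then obtain y0 where y0: "\<And>y. y \<in> {-Y..Y} \<Longrightarrow> norm (1 + fourier k y0) \<le> norm (1 + fourier k y)" by blast
  show ?thesis
  proof (rule that[of "min (1/2) (norm (1 + fourier k y0))"])
    fix y :: real
    show "min (1/2) (norm (1 + fourier k y0)) \<le> norm (1 + fourier k y)"
    proof (cases "y \<in> {-Y..Y}")
      case False
      then have "Y \<le> \<bar>y\<bar>" by auto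
      moreover have "\<bar>y\<bar> \<le> \<bar>y\<bar> * \<bar>y\<bar>" using \<open>Y \<le> \<bar>y\<bar>\<close> mult_left_mono[of 1 "\<bar>y\<bar>" "\<bar>y\<bar>"] by (simp add: Y_def)
      ultimately have "4 * B \<le> 1 + y\<^sup>2" by (simp add: Y_def power2_eq_square)
      then show ?thesis using far by (simp add: min.coboundedI1)
    qed (use y0 in \<open>simp add: min.coboundedI2\<close>)
  qed (use nz in auto)
qed

text \<open>Split \<open>F k = K + R\<close> with \<open>K\<close> smooth and decaying and with \<open>R\<close> of norm at most \<open>r\<close>, where \<open>1 + K\<close> is
bounded below by \<open>m = 2 r\<close>. The terms of the geometric series for \<open>1 / (1 + K + R)\<close> then have norms of
order \<open>n\<^sup>2 (r / m)^n = n\<^sup>2 / 2^n\<close>.\<close>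

lemma wiener_inverse:
  assumes k: "integrable lborel k" and nz: "\<And>y. 1 + fourier k y \<noteq> 0"
  obtains \<eta> where "integrable lborel \<eta>" "\<And>y. fourier \<eta> y = fourier k y / (1 + fourier k y)"
proof -
  obtain \<delta> where \<delta>: "0 < \<delta>" "\<delta> \<le> 1" "\<And>y. \<delta> \<le> norm (1 + fourier k y)"
    using fourier_bounded_below[OF k nz] by blast
  define r where "r = \<delta> / 3"
  define m where "m = 2 * r"
  have r: "0 < r" and m: "0 < m" "m \<le> 1" using \<delta> by (auto simp: r_def m_def)
  obtain k' where k': "integrable lborel k'" "decaying_C2 (fourier k')" and d: "(LINT x|lborel. norm (k x - k' x)) < r"
    using decaying_C2_dense[OF k r] by auto
  define K where "K = fourier k'"
  obtain K1 K2 B0 where d1: "\<And>y. (K has_vector_derivative K1 y) (at y)" and d2: "\<And>y. (K1 has_vector_derivative K2 y) (at y)"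
    and cont: "continuous_on UNIV K2"
    and b0: "\<And>y. norm (K y) \<le> B0 / (1 + y\<^sup>2)" "\<And>y. norm (K1 y) \<le> B0 / (1 + y\<^sup>2)" "\<And>y. norm (K2 y) \<le> B0 / (1 + y\<^sup>2)"
    using k'(2) unfolding decaying_C2_def K_def by blast
  define B where "B = max 1 B0"
  have "B0 / (1 + y\<^sup>2) \<le> B / (1 + y\<^sup>2)" for y :: real
    unfolding B_def by (intro divide_right_mono) (auto simp: add_nonneg_nonneg)
  note b = order_trans[OF b0(1) this] order_trans[OF b0(2) this] order_trans[OF b0(3) this]
  define R where "R y = fourier k y - K y" for y
  have R: "fourier_ball R r"
    unfolding fourier_ball_def R_def K_def using k k' d
    by (intro exI[of _ "\<lambda>x. k x - k' x"]) (auto simp: fourier_diff)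
  have Rr: "norm (R y) \<le> r" for y
    using norm_fourier_le[of "\<lambda>x. k x - k' x" y] d k k' by (simp add: R_def K_def fourier_diff)
  have low: "m \<le> norm (1 + K y)" for y
    using norm_triangle_ineq4[of "1 + fourier k y" "R y"] Rr[of y] \<delta>(3)[of y] norm_triangle_ineq[of "1 + K y" "R y"]
    by (simp add: R_def m_def r_def)
  define Q where "Q y = inverse (1 + K y)" for y
  \<comment> \<open>The constant function \<open>1\<close> is not in the Fourier algebra, so it is removed: \<open>T n\<close> is the \<open>n\<close>-th term
\<open>(- R)^n Q^(n + 1)\<close> of the geometric series, diminished by \<open>1\<close> for \<open>n = 0\<close>.\<close>
  define T where "T n y = (- R y) ^ n * (Q y ^ Suc n - 1) + (if n = 0 then 0 else (- R y) ^ n)" for n y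
  define c where "c n = r ^ n * (pi * (2 * B\<^sup>2 * (real (n + 1) * real (n + 2)) / m ^ (n + 3))) + r ^ n" for n
  have "fourier_ball (T n) (c n)" for n
  proof -
    have 1: "fourier_ball (\<lambda>y. (- R y) ^ n * (Q y ^ Suc n - 1))
        (r ^ n * (pi * (2 * B\<^sup>2 * (real (n + 1) * real (n + 2)) / m ^ (n + 3))))"
      unfolding Q_def
      by (intro fourier_ball_power_mult fourier_ball_uminus R fourier_ball_inverse_power[OF d1 d2 cont b _ m low])
         (simp add: B_def)
    have 2: "fourier_ball (\<lambda>y. if n = 0 then 0 else (- R y) ^ n) (r ^ n)"
    proof (cases n)
      case 0
      then show ?thesis unfolding fourier_ball_def by (intro exI[of _ "\<lambda>_. 0"]) (simp add: fourier_def)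
    next
      case (Suc j)
      then show ?thesis
        using fourier_ball_power_mult[OF fourier_ball_uminus[OF R] fourier_ball_uminus[OF R], of j] by (simp add: mult.commute)
    qed
    show ?thesis unfolding T_def c_def by (rule fourier_ball_add[OF 1 2])
  qed
  moreover have "summable c"
  proof -
    have "summable (\<lambda>n. real (n + 1) * real (n + 2) * (1/2) ^ n)"
    proof (rule summable_comparison_test_bigo)
      show "summable (\<lambda>n. norm ((3/4::real) ^ n))" by simp
      show "(\<lambda>n. real (n + 1) * real (n + 2) * (1/2) ^ n) \<in> O(\<lambda>n. (3/4) ^ n)" by real_asymp
    qed
    then have "summable (\<lambda>n. (2 * pi * B\<^sup>2 / m ^ 3) * (real (n + 1) * real (n + 2) * (1/2) ^ n) + r ^ n)"
      using \<delta> by (intro summable_add summable_mult summable_geometric) (auto simp: r_def)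
    moreover have "c n = (2 * pi * B\<^sup>2 / m ^ 3) * (real (n + 1) * real (n + 2) * (1/2) ^ n) + r ^ n" for n
    proof -
      have "r ^ n / m ^ (n + 3) = (1/2) ^ n / m ^ 3"
        using r by (simp add: m_def power_add power_mult_distrib field_simps)
      then have "r ^ n * (X / m ^ (n + 3)) = X * ((1/2) ^ n / m ^ 3)" for X
        by (metis times_divide_eq_left times_divide_eq_right mult.commute)
      from this[of "pi * (2 * B\<^sup>2 * (real (n + 1) * real (n + 2)))"] show ?thesis
        unfolding c_def by (simp add: algebra_simps)
    qed
    then have "c = (\<lambda>n. (2 * pi * B\<^sup>2 / m ^ 3) * (real (n + 1) * real (n + 2) * (1/2) ^ n) + r ^ n)" by (rule ext)
    ultimately show ?thesis by (simp only:)
  qed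
  ultimately have S: "fourier_ball (\<lambda>y. \<Sum>n. T n y) (\<Sum>n. c n)" by (rule fourier_ball_suminf)
  have "(\<Sum>n. T n y) = 1 / (1 + fourier k y) - 1" for y
  proof -
    have P: "1 + K y \<noteq> 0" using low[of y] m by auto
    have "norm (R y * Q y) \<le> r * (1 / m)"
      unfolding norm_mult using Rr[of y] le_imp_inverse_le[OF low[of y]] m r
      by (intro mult_mono) (auto simp: Q_def norm_inverse inverse_eq_divide[symmetric] simp del: inverse_eq_divide)
    then have "norm (- R y * Q y) < 1" using r by (simp add: m_def)
    then have "(\<lambda>n. Q y * (- R y * Q y) ^ n) sums (Q y * (1 / (1 - (- R y * Q y))))"
      by (intro sums_mult geometric_sums)
    moreover have "(\<lambda>n. if n = 0 then 1 else 0 :: complex) sums 1"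
      using sums_single[of 0 "\<lambda>_. 1 :: complex"] by simp
    ultimately have "(\<lambda>n. Q y * (- R y * Q y) ^ n - (if n = 0 then 1 else 0)) sums (Q y * (1 / (1 - (- R y * Q y))) - 1)"
      by (rule sums_diff)
    moreover have "Q y * (- R y * Q y) ^ n - (if n = 0 then 1 else 0) = T n y" for n
      unfolding T_def power_mult_distrib by (simp add: right_diff_distrib mult_ac)
    moreover have "Q y * (1 / (1 - (- R y * Q y))) = 1 / (1 + fourier k y)"
    proof -
      have "(1 + K y) * (1 - (- R y * Q y)) = 1 + fourier k y" using P by (simp add: Q_def R_def field_simps)
      then show ?thesis by (metis Q_def inverse_eq_divide mult_1 times_divide_times_eq)
    qed
    ultimately show ?thesis by (simp add: sums_iff)
  qed
  with fourier_ball_uminus[OF S] have "fourier_ball (\<lambda>y. - (1 / (1 + fourier k y) - 1)) (\<Sum>n. c n)" by simp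
  then obtain \<eta> where "integrable lborel \<eta>" "\<And>y. fourier \<eta> y = - (1 / (1 + fourier k y) - 1)"
    unfolding fourier_ball_def by blast
  moreover have "- (1 / (1 + fourier k y) - 1) = fourier k y / (1 + fourier k y)" for y
    using nz[of y] by (simp add: field_simps)
  ultimately show ?thesis using that by simp
qed

section \<open>Second derivatives of convolutions with the exponential kernel\<close>

lemma has_real_derivative_abs:
  assumes t: "(t::real) \<noteq> 0"
  shows "(abs has_real_derivative sgn t) (at t)"
proof -
  have "((\<lambda>s. sgn t * s) has_real_derivative sgn t) (at t)" by (auto intro!: derivative_eq_intros)
  then show ?thesis
    by (rule has_field_derivative_transform_within_open[of _ _ _ "if t > 0 then {0<..} else {..<0}"])
       (use t in \<open>auto split: if_splits\<close>)
qed

lemma exp_neg_abs_lipschitz: "\<bar>exp (- \<bar>a\<bar>) - exp (- \<bar>b\<bar>)\<bar> \<le> \<bar>a - b\<bar>" for a b :: real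
proof -
  have *: "\<bar>exp (- s) - exp (- t)\<bar> \<le> t - s" if "0 \<le> s" "s \<le> t" for s t :: real
  proof -
    have "exp (- t) = exp (- s) * exp (- (t - s))" by (subst exp_add[symmetric]) simp
    then have "exp (- s) - exp (- t) = exp (- s) * (1 - exp (- (t - s)))"
      by (simp only: right_diff_distrib mult_1_right)
    also have "1 - exp (- (t - s)) \<le> t - s"
      using exp_ge_add_one_self[of "- (t - s)"] by linarith
    then have "exp (- s) * (1 - exp (- (t - s))) \<le> 1 * (t - s)"
      using that by (intro mult_mono) auto
    finally show ?thesis using that by simp
  qed
  show ?thesis
  proof (cases "\<bar>a\<bar> \<le> \<bar>b\<bar>")
    case True
    from *[OF abs_ge_zero this] show ?thesis
      by (rule order_trans) (metis abs_triangle_ineq2 abs_minus_commute)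
  next
    case False
    then have "\<bar>b\<bar> \<le> \<bar>a\<bar>" by simp
    from *[OF abs_ge_zero this] have "\<bar>exp (- \<bar>a\<bar>) - exp (- \<bar>b\<bar>)\<bar> \<le> \<bar>a\<bar> - \<bar>b\<bar>"
      by (simp only: abs_minus_commute)
    then show ?thesis by (rule order_trans) (rule abs_triangle_ineq2)
  qed
qed

lemma odd_exp_lipschitz:
  "\<bar>sgn a * (1 - exp (- \<bar>a\<bar>)) - sgn b * (1 - exp (- \<bar>b\<bar>))\<bar> \<le> \<bar>a - b\<bar>" for a b :: real
proof -
  have e: "1 - exp (- \<bar>t\<bar>) \<le> \<bar>t\<bar>" "0 \<le> 1 - exp (- \<bar>t\<bar>)" for t :: real
    using exp_ge_add_one_self[of "- \<bar>t\<bar>"] by auto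
  have "\<bar>sgn a * (1 - p) - sgn b * (1 - q)\<bar> \<le> \<bar>a - b\<bar>"
    if "1 - p \<le> \<bar>a\<bar>" "0 \<le> 1 - p" "1 - q \<le> \<bar>b\<bar>" "0 \<le> 1 - q" "\<bar>p - q\<bar> \<le> \<bar>a - b\<bar>" for p q
    using that by (auto simp: sgn_if abs_if split: if_splits)
  then show ?thesis
    using exp_neg_abs_lipschitz[of a b] e[of a] e[of b] by blast
qed

text \<open>For fixed \<open>x\<close> the kernel fails to be differentiable only at \<open>y = x\<close>, a null set, and the Lipschitz
condition dominates the difference quotients by \<open>\<bar>f\<bar>\<close>. So the derivative exists at every \<open>x\<close>, although
\<open>f\<close> is merely integrable.\<close>

lemma has_vector_derivative_conv_lipschitz:
  fixes f :: "real \<Rightarrow> complex" and \<phi> \<psi> :: "real \<Rightarrow> real"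
  assumes f: "integrable lborel f"
    and [measurable]: "\<phi> \<in> borel_measurable borel" "\<psi> \<in> borel_measurable borel"
    and bdd: "\<And>t. \<bar>\<phi> t\<bar> \<le> 1" and lip: "\<And>a b. \<bar>\<phi> a - \<phi> b\<bar> \<le> \<bar>a - b\<bar>"
    and deriv: "\<And>t. t \<noteq> 0 \<Longrightarrow> (\<phi> has_real_derivative \<psi> t) (at t)"
  shows "((\<lambda>x. LINT y|lborel. f y * of_real (\<phi> (x - y))) has_vector_derivative
          (LINT y|lborel. f y * of_real (\<psi> (x - y)))) (at x)"
proof (rule has_vector_derivative_integral[where w="\<lambda>y. norm (f y)"])
  have [measurable]: "f \<in> borel_measurable borel" using f by auto
  show "integrable lborel (\<lambda>y. f y * of_real (\<phi> (z - y)))" for z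
    by (rule Bochner_Integration.integrable_bound[OF f]) (use bdd in \<open>auto simp: norm_mult mult_left_le\<close>)
  show "(\<lambda>y. f y * of_real (\<psi> (x - y))) \<in> borel_measurable borel" by measurable
  show "AE y in lborel. ((\<lambda>z. f y * of_real (\<phi> (z - y))) has_vector_derivative f y * of_real (\<psi> (x - y))) (at x)"
    using AE_lborel_singleton[of x]
  proof eventually_elim
    case (elim y)
    have "((\<lambda>z. \<phi> (z - y)) has_real_derivative \<psi> (x - y) * 1) (at x)"
      by (rule DERIV_chain2[OF deriv]) (use elim in \<open>auto intro!: derivative_eq_intros\<close>)
    then show ?case
      by (intro has_vector_derivative_mult_right has_vector_derivative_of_real) simp
  qed
  show "norm (f y * of_real (\<phi> (z - y)) - f y * of_real (\<phi> (x - y))) \<le> \<bar>z - x\<bar> * norm (f y)" for z y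
  proof -
    have "norm (f y * of_real (\<phi> (z - y)) - f y * of_real (\<phi> (x - y))) = norm (f y) * \<bar>\<phi> (z - y) - \<phi> (x - y)\<bar>"
      by (simp only: right_diff_distrib[symmetric] norm_mult of_real_diff[symmetric] norm_of_real)
    also have "\<dots> \<le> norm (f y) * \<bar>z - x\<bar>" using lip[of "z - y" "x - y"] by (intro mult_left_mono) auto
    finally show ?thesis by (simp add: mult.commute)
  qed
qed (use f in simp)

text \<open>Up to an additive constant, \<open>sgn_conv f\<close> is twice the indefinite integral of \<open>f\<close>. It carries the jump of the
derivative of \<open>exp (- \<bar>x\<bar>)\<close>.\<close>

definition sgn_conv :: "(real \<Rightarrow> complex) \<Rightarrow> real \<Rightarrow> complex" where
  "sgn_conv f x = (LINT y|lborel. f y * of_real (sgn (x - y)))"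

lemma integrable_mult_sgn:
  assumes f: "integrable lborel f"
  shows "integrable lborel (\<lambda>y. f y * of_real (sgn (x - y :: real)) :: complex)"
proof -
  have [measurable]: "f \<in> borel_measurable borel" using f by auto
  show ?thesis
    by (rule Bochner_Integration.integrable_bound[OF f]) (auto simp: norm_mult sgn_if)
qed

text \<open>Over a step \<open>h > 0\<close> the increment is twice the integral of \<open>f\<close> over \<open>[x, x + h]\<close>; this reduces the
claim to the one-sided Lebesgue differentiation theorem.\<close>

lemma sgn_conv_right_derivative:
  assumes f: "integrable lborel f"
  obtains N where "negligible N"
    "\<And>x. x \<notin> N \<Longrightarrow> ((\<lambda>z. (sgn_conv f z - sgn_conv f x) /\<^sub>R (z - x)) \<longlongrightarrow> 2 * f x) (at_right x)"
proof -
  have [measurable]: "f \<in> borel_measurable borel" using f by auto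
  have "f integrable_on cbox a b" for a b
    using integrable_on_lborel[OF f] by (rule integrable_on_subcbox) simp
  from integrable_ccontinuous_explicit[of f, OF this] obtain N where N: "negligible N" and
    lim: "\<And>x e. \<lbrakk>x \<notin> N; 0 < e\<rbrakk> \<Longrightarrow> \<exists>d>0. \<forall>h. 0 < h \<and> h < d \<longrightarrow>
       norm (integral (cbox x (x + h)) f /\<^sub>R h - f x) < e"
    by auto
  have int: "sgn_conv f (x + h) - sgn_conv f x = 2 * integral (cbox x (x + h)) f" if h: "0 < h" for x h
  proof -
    have si: "set_integrable lborel {x..x+h} f"
      unfolding set_integrable_def by (intro integrable_mult_indicator f) simp
    have "sgn_conv f (x + h) - sgn_conv f x
        = (LINT y|lborel. f y * of_real (sgn (x + h - y)) - f y * of_real (sgn (x - y)))"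
      unfolding sgn_conv_def using integrable_mult_sgn[OF f] by simp
    also have "\<dots> = (LINT y|lborel. 2 * (indicator {x..x+h} y *\<^sub>R f y))"
    proof (rule integral_cong_AE)
      show "AE y in lborel. f y * of_real (sgn (x + h - y)) - f y * of_real (sgn (x - y)) = 2 * (indicator {x..x+h} y *\<^sub>R f y)"
        using AE_lborel_singleton[of x] AE_lborel_singleton[of "x + h"]
        by eventually_elim (use h in \<open>auto simp: sgn_if indicator_def\<close>)
    qed measurable
    also have "\<dots> = 2 * integral {x..x+h} f"
      unfolding integral_mult_right_zero
      using set_borel_integral_eq_integral(2)[OF si] by (simp add: set_lebesgue_integral_def)
    finally show ?thesis by simp
  qed
  show ?thesis
  proof (rule that[OF N])
    fix x assume x: "x \<notin> N"
    have "((\<lambda>h. integral (cbox x (x + h)) f /\<^sub>R h) \<longlongrightarrow> f x) (at_right 0)"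
      unfolding tendsto_iff dist_norm eventually_at_right_field
      using lim[OF x] by (metis add_0)
    then have "((\<lambda>h. 2 * (integral (cbox x (x + h)) f /\<^sub>R h)) \<longlongrightarrow> 2 * f x) (at_right 0)"
      by (intro tendsto_intros)
    moreover have "\<forall>\<^sub>F h in at_right 0. 2 * (integral (cbox x (x + h)) f /\<^sub>R h) = (sgn_conv f (h + x) - sgn_conv f x) /\<^sub>R (h + x - x)"
      using eventually_at_right_less[of 0]
    proof eventually_elim
      case (elim h)
      then show ?case using int[of h x] by (simp add: add.commute)
    qed
    ultimately show "((\<lambda>z. (sgn_conv f z - sgn_conv f x) /\<^sub>R (z - x)) \<longlongrightarrow> 2 * f x) (at_right x)"
      unfolding filterlim_at_right_to_0[of _ _ x] by (rule Lim_transform_eventually)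
  qed
qed

text \<open>The left derivative of \<open>sgn_conv f\<close> at \<open>x\<close> is the right derivative, at \<open>- x\<close>, of \<open>sgn_conv\<close> of the
reflected function.\<close>

lemma AE_sgn_conv_derivative:
  assumes f: "integrable lborel f"
  shows "AE x in lborel. (sgn_conv f has_vector_derivative 2 * f x) (at x)"
proof -
  let ?r = "\<lambda>y. f (- y)"
  have r: "integrable lborel ?r" by (rule integrable_reflect[OF f])
  obtain N where N: "negligible N"
    "\<And>x. x \<notin> N \<Longrightarrow> ((\<lambda>z. (sgn_conv f z - sgn_conv f x) /\<^sub>R (z - x)) \<longlongrightarrow> 2 * f x) (at_right x)"
    using sgn_conv_right_derivative[OF f] by blast
  obtain N' where N': "negligible N'"
    "\<And>x. x \<notin> N' \<Longrightarrow> ((\<lambda>z. (sgn_conv ?r z - sgn_conv ?r x) /\<^sub>R (z - x)) \<longlongrightarrow> 2 * ?r x) (at_right x)"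
    using sgn_conv_right_derivative[OF r] by blast
  have reflect: "sgn_conv ?r x = - sgn_conv f (- x)" for x
  proof -
    have "sgn (- x + y) = - sgn (x - y)" for y :: real by (simp add: sgn_if)
    then show ?thesis
      using lborel_integral_real_affine[of "-1" "\<lambda>y. f y * of_real (sgn (- x - y))" 0]
      by (simp add: sgn_conv_def)
  qed
  have "negligible (uminus ` N')" using N'(1) by (intro negligible_differentiable_image_negligible) (auto intro: differentiable_on_minus)
  then have "AE x in lborel. x \<notin> N \<union> uminus ` N'"
    using N(1) by (intro negligible_AE_lborel) simp
  then show ?thesis
  proof eventually_elim
    case (elim x)
    then have x: "x \<notin> N" "- x \<notin> N'" by (auto simp: image_iff)
    have "((\<lambda>z. (sgn_conv f z - sgn_conv f x) /\<^sub>R (z - x)) \<longlongrightarrow> 2 * f x) (at_left x)"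
    proof -
      have "(sgn_conv f (- z) - sgn_conv f x) /\<^sub>R (- z - x) = (sgn_conv ?r z - sgn_conv ?r (- x)) /\<^sub>R (z - (- x))" for z
      proof -
        have "inverse (- z - x) = - inverse (z + x)" by (metis inverse_minus_eq minus_add_distrib diff_conv_add_uminus)
        then show ?thesis by (simp add: reflect scaleR_diff_right)
      qed
      then show ?thesis
        unfolding filterlim_at_left_to_right[of _ _ x] using N'(2)[OF x(2)] by simp
    qed
    with N(2)[OF x(1)] show ?case
      unfolding has_vector_derivative_at_iff_quotient by (simp add: filterlim_at_split)
  qed
qed

text \<open>The first derivative of \<open>u\<close> is half the convolution with the kernel \<open>\<psi> t = - sgn t exp (- \<bar>t\<bar>)\<close>. This
kernel jumps at \<open>0\<close>; write it as \<open>\<theta> - sgn\<close> with \<open>\<theta> t = sgn t (1 - exp (- \<bar>t\<bar>))\<close>. The function \<open>\<theta>\<close> is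
Lipschitz with derivative \<open>exp (- \<bar>t\<bar>)\<close> and contributes \<open>u\<close> everywhere; the jump part contributes
\<open>- f\<close> at almost every point.\<close>

lemma AE_second_derivative_exp_conv:
  assumes f: "integrable lborel f"
    and u: "u = (\<lambda>x. (1/2) * (LINT y|lborel. f y * of_real (exp (- \<bar>x - y\<bar>))))"
  shows "AE x in lborel. has_second_derivative u (u x - f x) x"
proof -
  have [measurable]: "f \<in> borel_measurable borel" using f by auto
  define \<psi> :: "real \<Rightarrow> real" where "\<psi> t = - sgn t * exp (- \<bar>t\<bar>)" for t
  define \<theta> :: "real \<Rightarrow> real" where "\<theta> t = sgn t * (1 - exp (- \<bar>t\<bar>))" for t
  define V where "V x = (LINT y|lborel. f y * of_real (\<psi> (x - y)))" for x
  have [measurable]: "\<psi> \<in> borel_measurable borel" "\<theta> \<in> borel_measurable borel"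
    unfolding \<psi>_def[abs_def] \<theta>_def[abs_def] by measurable
  have \<theta>_le: "\<bar>\<theta> t\<bar> \<le> 1" for t by (simp add: \<theta>_def abs_mult sgn_if)
  have dexp: "((\<lambda>t. exp (- \<bar>t\<bar>)) has_real_derivative \<psi> t) (at t)" if "t \<noteq> 0" for t
    using DERIV_fun_exp[OF DERIV_minus[OF has_real_derivative_abs[OF that]]] by (simp add: \<psi>_def mult.commute)
  have dl: "(\<theta> has_real_derivative exp (- \<bar>t\<bar>)) (at t)" if t: "t \<noteq> 0" for t
  proof -
    have "((\<lambda>s. sgn t * (1 - exp (- \<bar>s\<bar>))) has_real_derivative exp (- \<bar>t\<bar>)) (at t)"
    proof -
      have "sgn t * (0 - \<psi> t) = exp (- \<bar>t\<bar>)" using t by (simp add: \<psi>_def sgn_if)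
      then show ?thesis
        using DERIV_cmult[OF DERIV_diff[OF DERIV_const[of 1] dexp[OF t]], of "sgn t"] by (simp only:)
    qed
    then show ?thesis
      by (rule has_field_derivative_transform_within_open[of _ _ _ "if t > 0 then {0<..} else {..<0}"])
         (use t in \<open>auto simp: \<theta>_def split: if_splits\<close>)
  qed
  have dU: "(u has_vector_derivative (1/2) * V x) (at x)" for x
    unfolding u V_def
    by (intro has_vector_derivative_mult_right has_vector_derivative_conv_lipschitz f exp_neg_abs_lipschitz dexp) auto
  have split: "V x = (LINT y|lborel. f y * of_real (\<theta> (x - y))) - sgn_conv f x" for x
  proof -
    have "integrable lborel (\<lambda>y. f y * of_real (\<theta> (x - y)))"
      by (rule Bochner_Integration.integrable_bound[OF f]) (use \<theta>_le in \<open>auto simp: norm_mult mult_left_le\<close>)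
    moreover have "f y * of_real (\<psi> (x - y)) = f y * of_real (\<theta> (x - y)) - f y * of_real (sgn (x - y))" for y
      by (simp add: \<psi>_def \<theta>_def algebra_simps)
    ultimately show ?thesis
      unfolding V_def sgn_conv_def using integrable_mult_sgn[OF f] by simp
  qed
  have dL: "((\<lambda>x. LINT y|lborel. f y * of_real (\<theta> (x - y))) has_vector_derivative 2 * u x) (at x)" for x
  proof -
    have "((\<lambda>x. LINT y|lborel. f y * of_real (\<theta> (x - y))) has_vector_derivative
       (LINT y|lborel. f y * of_real (exp (- \<bar>x - y\<bar>)))) (at x)"
      by (intro has_vector_derivative_conv_lipschitz f dl)
         (use \<theta>_le odd_exp_lipschitz in \<open>auto simp: \<theta>_def\<close>)
    then show ?thesis by (simp add: u)
  qed
  from AE_sgn_conv_derivative[OF f] show ?thesis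
  proof eventually_elim
    case (elim x)
    have "((\<lambda>x. (1/2) * V x) has_vector_derivative (1/2) * (2 * u x - 2 * f x)) (at x)"
      unfolding split by (intro has_vector_derivative_mult_right has_vector_derivative_diff dL elim)
    then show ?case
      unfolding has_second_derivative_def using dU
      by (intro exI[of _ "\<lambda>x. (1/2) * V x"]) (simp add: right_diff_distrib)
  qed
qed

lemma has_second_derivative_unique:
  assumes "has_second_derivative u d x" "has_second_derivative u d' x"
  shows "d = d'"
proof -
  obtain v v' where v: "\<forall>\<^sub>F z in nhds x. (u has_vector_derivative v z) (at z)" "(v has_vector_derivative d) (at x)"
    and v': "\<forall>\<^sub>F z in nhds x. (u has_vector_derivative v' z) (at z)" "(v' has_vector_derivative d') (at x)"
    using assms unfolding has_second_derivative_def by blast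
  have eq: "\<forall>\<^sub>F z in nhds x. v z = v' z"
    using v(1) v'(1) by eventually_elim (rule vector_derivative_unique_at)
  then obtain S where S: "open S" "x \<in> S" "\<And>z. z \<in> S \<Longrightarrow> v z = v' z"
    unfolding eventually_nhds by blast
  have "(v' has_vector_derivative d) (at x)"
    by (rule has_vector_derivative_transform_within_open[OF v(2) S])
  then show ?thesis using v'(2) by (rule vector_derivative_unique_at)
qed

section \<open>The Hartley convolution\<close>

lemma L1_norm_eq:
  assumes f: "integrable lborel f0" and eq: "AE x in lborel. f x = f0 x"
  shows "L1_norm f = (LINT x|lborel. norm (f0 x))"
  unfolding L1_norm_def
  by (rule lebesgue_integral_AE_eq_lborel) (use f eq in auto)

lemma hartley_conv_eq_lborel:
  assumes f: "integrable lborel f0" and g: "integrable lborel g0"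
    and ef: "AE x in lborel. f x = f0 x" and eg: "AE x in lborel. g x = g0 x"
  shows "hartley_conv f g x = (1 / (2 * sqrt (2 * pi))) *\<^sub>R
      (LINT y|lborel. f0 y * (g0 (x + y) + g0 (x - y) + g0 (- x + y) - g0 (- x - y)))"
proof -
  have [measurable]: "f0 \<in> borel_measurable borel" "g0 \<in> borel_measurable borel" using f g by auto
  have shift: "AE y in lborel. g (x + y) = g0 (x + y)" "AE y in lborel. g (x - y) = g0 (x - y)"
    "AE y in lborel. g (- x + y) = g0 (- x + y)" "AE y in lborel. g (- x - y) = g0 (- x - y)"
    using AE_lborel_affine[OF eg, of 1 x] AE_lborel_affine[OF eg, of "-1" x]
      AE_lborel_affine[OF eg, of 1 "-x"] AE_lborel_affine[OF eg, of "-1" "-x"] by simp_all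
  have "AE y in lborel. f y * (g (x + y) + g (x - y) + g (- x + y) - g (- x - y))
      = f0 y * (g0 (x + y) + g0 (x - y) + g0 (- x + y) - g0 (- x - y))"
    using ef shift by eventually_elim simp
  then show ?thesis
    unfolding hartley_conv_def by (subst lebesgue_integral_AE_eq_lborel) auto
qed

text \<open>The equality holds at every point, not only almost everywhere, so derivatives of a Hartley
convolution may be computed with Borel representatives.\<close>

lemma hartley_conv_cong_AE:
  assumes "integrable lborel f0" "integrable lborel g0"
    and "AE x in lborel. f x = f0 x" "AE x in lborel. g x = g0 x"
  shows "hartley_conv f g = hartley_conv f0 g0"
  using hartley_conv_eq_lborel[OF assms] hartley_conv_eq_lborel[OF assms(1,2)] by (simp add: fun_eq_iff)

definition signed_conv_sum :: "(real \<Rightarrow> complex) \<Rightarrow> (real \<Rightarrow> complex) \<Rightarrow> real \<Rightarrow> complex" where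
  "signed_conv_sum f g x = signed_conv 1 1 f g x + signed_conv 1 (-1) f g x + signed_conv (-1) 1 f g x - signed_conv (-1) (-1) f g x"

context
  fixes f g :: "real \<Rightarrow> complex"
  assumes f: "integrable lborel f" and g: "integrable lborel g"
begin

lemma integrable_signed_conv_sum: "integrable lborel (signed_conv_sum f g)"
  unfolding signed_conv_sum_def[abs_def]
  by (intro Bochner_Integration.integrable_add Bochner_Integration.integrable_diff integrable_signed_conv f g) auto

lemma AE_hartley_conv_eq: "AE x in lborel. hartley_conv f g x = (1 / (2 * sqrt (2 * pi))) *\<^sub>R signed_conv_sum f g x"
proof -
  have "AE x in lborel. integrable lborel (\<lambda>y. f y * g (1 * x + 1 * y))"
    "AE x in lborel. integrable lborel (\<lambda>y. f y * g (1 * x + (-1) * y))"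
    "AE x in lborel. integrable lborel (\<lambda>y. f y * g ((-1) * x + 1 * y))"
    "AE x in lborel. integrable lborel (\<lambda>y. f y * g ((-1) * x + (-1) * y))"
    by (intro AE_signed_conv_integrable f g; simp)+
  then show ?thesis
  proof eventually_elim
    case (elim x)
    then show ?case
      by (subst hartley_conv_eq_lborel[OF f g]) (simp_all add: signed_conv_sum_def signed_conv_def distrib_left right_diff_distrib)
  qed
qed

lemma integrable_hartley_conv: "integrable lborel (hartley_conv f g)"
proof (rule integrable_cong_AE_imp[of _ "\<lambda>x. (1 / (2 * sqrt (2 * pi))) *\<^sub>R signed_conv_sum f g x"])
  have [measurable]: "f \<in> borel_measurable borel" "g \<in> borel_measurable borel" using f g by auto
  have "(\<lambda>x. LINT y|lborel. f y * (g (x + y) + g (x - y) + g (- x + y) - g (- x - y))) \<in> borel_measurable lborel"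
    by (rule lborel.borel_measurable_lebesgue_integral) measurable
  moreover have "hartley_conv f g = (\<lambda>x. (1 / (2 * sqrt (2 * pi))) *\<^sub>R
      (LINT y|lborel. f y * (g (x + y) + g (x - y) + g (- x + y) - g (- x - y))))"
    by (rule ext) (rule hartley_conv_eq_lborel[OF f g], auto)
  ultimately show "hartley_conv f g \<in> borel_measurable lborel" by simp
qed (use integrable_signed_conv_sum AE_hartley_conv_eq in \<open>auto simp: eq_commute\<close>)

lemma fourier_hartley_conv:
  "fourier (hartley_conv f g) y = of_real (1 / (2 * sqrt (2 * pi))) *
     (fourier f (- y) * fourier g y + fourier f y * fourier g y + fourier f y * fourier g (- y)
       - fourier f (- y) * fourier g (- y))"
proof -
  have "fourier (hartley_conv f g) y = fourier (\<lambda>x. of_real (1 / (2 * sqrt (2 * pi))) * signed_conv_sum f g x) y"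
    using integrable_hartley_conv integrable_signed_conv_sum AE_hartley_conv_eq
    by (intro fourier_cong_AE) (simp_all add: scaleR_conv_of_real)
  also have "\<dots> = of_real (1 / (2 * sqrt (2 * pi))) * fourier (signed_conv_sum f g) y" by (rule fourier_cmult)
  also have "fourier (signed_conv_sum f g) y = fourier (signed_conv 1 1 f g) y + fourier (signed_conv 1 (-1) f g) y + fourier (signed_conv (-1) 1 f g) y
      - fourier (signed_conv (-1) (-1) f g) y"
    unfolding signed_conv_sum_def[abs_def] by (simp add: fourier_add fourier_diff integrable_signed_conv f g)
  finally show ?thesis by (simp add: fourier_signed_conv f g)
qed

text \<open>Four convolution terms, each of norm at most the product of the norms, times the constant
\<open>1 / (2 sqrt (2 \<pi>))\<close>.\<close>

lemma norm_hartley_conv_le: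
  "(LINT x|lborel. norm (hartley_conv f g x)) \<le> sqrt (2 / pi) * (LINT x|lborel. norm (f x)) * (LINT x|lborel. norm (g x))"
proof -
  let ?A = "(LINT x|lborel. norm (f x)) * (LINT x|lborel. norm (g x))"
  have i: "integrable lborel (\<lambda>x. norm (signed_conv s t f g x))" if "\<bar>s\<bar> = 1" for s t
    using integrable_signed_conv[OF that f g] by simp
  have "(LINT x|lborel. norm (signed_conv_sum f g x)) \<le> (LINT x|lborel. norm (signed_conv 1 1 f g x) + norm (signed_conv 1 (-1) f g x)
      + norm (signed_conv (-1) 1 f g x) + norm (signed_conv (-1) (-1) f g x))"
  proof (intro integral_mono integrable_norm integrable_signed_conv_sum Bochner_Integration.integrable_add integrable_signed_conv f g)
    show "norm (signed_conv_sum f g x) \<le> norm (signed_conv 1 1 f g x) + norm (signed_conv 1 (-1) f g x)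
      + norm (signed_conv (-1) 1 f g x) + norm (signed_conv (-1) (-1) f g x)" for x
      unfolding signed_conv_sum_def by (intro order_trans[OF norm_triangle_ineq4] add_mono order_trans[OF norm_triangle_ineq] order_refl)
  qed auto
  also have "\<dots> = (LINT x|lborel. norm (signed_conv 1 1 f g x)) + (LINT x|lborel. norm (signed_conv 1 (-1) f g x))
      + (LINT x|lborel. norm (signed_conv (-1) 1 f g x)) + (LINT x|lborel. norm (signed_conv (-1) (-1) f g x))"
    by (simp add: i)
  also have "\<dots> \<le> ?A + ?A + ?A + ?A"
    by (intro add_mono norm_signed_conv_le f g) simp_all
  finally have four: "(LINT x|lborel. norm (signed_conv_sum f g x)) \<le> 4 * ?A" by simp
  have "(LINT x|lborel. norm (hartley_conv f g x)) = (LINT x|lborel. norm ((1 / (2 * sqrt (2 * pi))) *\<^sub>R signed_conv_sum f g x))"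
    using integrable_hartley_conv integrable_signed_conv_sum AE_hartley_conv_eq by (intro integral_cong_AE) auto
  then have "(LINT x|lborel. norm (hartley_conv f g x)) = (1 / (2 * sqrt (2 * pi))) * (LINT x|lborel. norm (signed_conv_sum f g x))" by simp
  then have "(LINT x|lborel. norm (hartley_conv f g x)) \<le> (1 / (2 * sqrt (2 * pi))) * (4 * ?A)"
    using mult_left_mono[OF four, of "1 / (2 * sqrt (2 * pi))"] by simp
  moreover have "(1 / (2 * sqrt (2 * pi))) * 4 = sqrt (2 / pi)"
    by (simp add: real_sqrt_divide real_sqrt_mult field_simps)
  ultimately show ?thesis by (simp only: mult.assoc[symmetric])
qed

end

section \<open>The Hartley transforms\<close>

text \<open>Both Hartley transforms in one family; the parameter satisfies \<open>a\<^sup>2 + (1 - a)\<^sup>2 = 0\<close>, that is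
\<open>a = (1 - i) / 2\<close> for \<open>hartley1\<close> and \<open>a = (1 + i) / 2\<close> for \<open>hartley2\<close>.\<close>

definition hartley_of :: "complex \<Rightarrow> (real \<Rightarrow> complex) \<Rightarrow> real \<Rightarrow> complex" where
  "hartley_of a f y = (a * fourier f y + (1 - a) * fourier f (- y)) / of_real (sqrt (2 * pi))"

lemma hartley_eq_hartley_of:
  assumes H: "H \<in> {hartley1, hartley2}"
  obtains a where "a * a + (1 - a) * (1 - a) = 0"
    "\<And>f f0 y. integrable lborel f0 \<Longrightarrow> AE x in lborel. f x = f0 x \<Longrightarrow> H f y = hartley_of a f0 y"
proof -
  define s :: real where "s = (if H = hartley1 then 1 else -1)"
  define a where "a = (1 - s * \<i>) / 2"
  have Hs: "H f y = (1 / sqrt (2 * pi)) *\<^sub>R (LINT x|lebesgue. f x * of_real (cos (x * y) + s * sin (x * y)))" for f y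
    using H by (auto simp: s_def hartley1_def hartley2_def)
  have ss: "s * s = 1" by (simp add: s_def)
  have cas: "of_real (cos (x * y) + s * sin (x * y)) = a * iexp (x * y) + (1 - a) * iexp (x * - y)" for x y :: real
    using ss by (simp add: a_def complex_eq_iff Re_exp Im_exp field_simps)
  show ?thesis
  proof (rule that[of a])
    show "a * a + (1 - a) * (1 - a) = 0"
      using ss by (simp add: a_def complex_eq_iff field_simps)
  next
    fix f f0 :: "real \<Rightarrow> complex" and y :: real
    assume f0: "integrable lborel f0" and eq: "AE x in lborel. f x = f0 x"
    have [measurable]: "f0 \<in> borel_measurable borel" using f0 by auto
    have "(LINT x|lebesgue. f x * of_real (cos (x * y) + s * sin (x * y)))
        = (LINT x|lborel. f0 x * of_real (cos (x * y) + s * sin (x * y)))"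
      by (rule lebesgue_integral_AE_eq_lborel) (measurable, use eq in eventually_elim, simp)
    also have "\<dots> = (LINT x|lborel. a * (f0 x * iexp (x * y)) + (1 - a) * (f0 x * iexp (x * - y)))"
      unfolding cas by (simp add: distrib_left mult_ac)
    also have "\<dots> = a * fourier f0 y + (1 - a) * fourier f0 (- y)"
      unfolding fourier_def
      by (subst Bochner_Integration.integral_add) (simp_all only: integrable_mult_right integrable_mult_iexp f0 integral_mult_right_zero)
    finally show "H f y = hartley_of a f0 y"
      unfolding Hs hartley_of_def by (simp add: scaleR_conv_of_real divide_inverse mult.commute)
  qed
qed

lemma hartley_of_add:
  assumes "integrable lborel f" "integrable lborel g"
  shows "hartley_of a (\<lambda>x. f x + g x) y = hartley_of a f y + hartley_of a g y"
  using assms by (simp add: hartley_of_def fourier_add add_divide_distrib[symmetric] algebra_simps)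

lemma hartley_of_cong_AE:
  assumes "integrable lborel u" "integrable lborel v" "AE x in lborel. u x = v x"
  shows "hartley_of a u y = hartley_of a v y"
  using fourier_cong_AE[OF assms] by (simp add: hartley_of_def)

context
  fixes a :: complex
  assumes a: "a * a + (1 - a) * (1 - a) = 0"
begin

lemma a_square: "a * a = a - 1 / 2"
  using a by (simp add: field_simps)

text \<open>By \<open>fourier_hartley_conv\<close> both sides are bilinear in the values of the two Fourier transforms at
\<open>\<plusminus>y\<close>, and the coefficients agree because \<open>2 a\<^sup>2 = a - (1 - a)\<close>, \<open>2 (1 - a)\<^sup>2 = (1 - a) - a\<close> and
\<open>2 a (1 - a) = 1\<close>.\<close>

lemma hartley_of_conv:
  assumes f: "integrable lborel f" and g: "integrable lborel g"
  shows "hartley_of a (hartley_conv f g) y = hartley_of a f y * hartley_of a g y"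
proof -
  define F F' G G' where "F = fourier f y" "F' = fourier f (- y)" "G = fourier g y" "G' = fourier g (- y)"
  note FG = this
  define s :: complex where "s = of_real (sqrt (2 * pi))"
  have s: "s \<noteq> 0" by (simp add: s_def)
  have "a * (F' * G + F * G + F * G' - F' * G') + (1 - a) * (F * G' + F' * G' + F' * G - F * G)
      = 2 * ((a * F + (1 - a) * F') * (a * G + (1 - a) * G'))"
    using a_square by algebra
  moreover have "(a * (1 / (2 * s) * P) + b * (1 / (2 * s) * P')) / s = (a * P + b * P') / (2 * (s * s))" for b P P'
    using s by (simp add: field_simps)
  ultimately have "(a * (1 / (2 * s) * (F' * G + F * G + F * G' - F' * G')) + (1 - a) * (1 / (2 * s) * (F * G' + F' * G' + F' * G - F * G))) / s
     = ((a * F + (1 - a) * F') / s) * ((a * G + (1 - a) * G') / s)"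
    by (simp only: times_divide_times_eq) simp
  then show ?thesis
    unfolding hartley_of_def fourier_hartley_conv[OF f g] minus_minus FG s_def by simp
qed

text \<open>The values \<open>D y\<close> and \<open>D (- y)\<close> of the Fourier transform of the difference solve a homogeneous linear
system with matrix entries \<open>a\<close>, \<open>1 - a\<close>; its determinant \<open>a\<^sup>2 - (1 - a)\<^sup>2 = 2 a\<^sup>2\<close> is not zero.\<close>

lemma hartley_of_unique:
  assumes f: "integrable lborel f" and g: "integrable lborel g"
    and eq: "\<And>y. hartley_of a f y = hartley_of a g y"
  shows "AE x in lborel. f x = g x"
proof -
  define D where "D = fourier (\<lambda>x. f x - g x)"
  have D: "a * D y + (1 - a) * D (- y) = 0" for y
    using eq[of y] f g by (simp add: D_def hartley_of_def fourier_diff) (simp add: algebra_simps)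
  have "D y = 0" for y
  proof -
    have "a * D (- y) + (1 - a) * D y = 0" using D[of "- y"] by simp
    with D[of y] a_square show ?thesis by algebra
  qed
  then have "AE x in lborel. f x - g x = 0"
    using f g by (intro fourier_unique) (auto simp: D_def)
  then show ?thesis by simp
qed

text \<open>The Hartley transform of \<open>h\<close> is the Fourier transform of the combination \<open>k\<close> of \<open>h\<close> and its
reflection. The inverse of the map \<open>h \<mapsto> k\<close> has the same form with \<open>a\<close> and \<open>1 - a\<close> exchanged; it is
applied to the function that Wiener's theorem gives for \<open>k\<close>.\<close>

lemma hartley_of_wiener:
  assumes h: "integrable lborel h" and nz: "\<And>y. 1 + hartley_of a h y \<noteq> 0"
  obtains \<eta> where "integrable lborel \<eta>" "\<And>y. hartley_of a \<eta> y = hartley_of a h y / (1 + hartley_of a h y)"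
proof -
  define s :: complex where "s = of_real (sqrt (2 * pi))"
  have s: "s \<noteq> 0" by (simp add: s_def)
  have r: "integrable lborel (\<lambda>x. c * f x + d * f (- x))" if "integrable lborel f" for c d and f :: "real \<Rightarrow> complex"
    using that integrable_reflect[OF that] by simp
  have Fr: "fourier (\<lambda>x. c * f x + d * f (- x)) y = c * fourier f y + d * fourier f (- y)" if "integrable lborel f" for c d y and f :: "real \<Rightarrow> complex"
    using that integrable_reflect[OF that] by (subst fourier_add) (auto simp: fourier_cmult fourier_reflect)
  define k where "k x = (a / s) * h x + ((1 - a) / s) * h (- x)" for x
  have k: "integrable lborel k" "fourier k y = hartley_of a h y" for y
  proof -
    show "integrable lborel k" unfolding k_def[abs_def] by (rule r[OF h])
    show "fourier k y = hartley_of a h y"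
      unfolding k_def[abs_def] Fr[OF h] by (simp add: hartley_of_def s_def add_divide_distrib)
  qed
  from nz have "\<And>y. 1 + fourier k y \<noteq> 0" by (simp add: k(2))
  from wiener_inverse[OF k(1) this] obtain \<kappa> where \<kappa>: "integrable lborel \<kappa>"
    "\<And>y. fourier \<kappa> y = hartley_of a h y / (1 + hartley_of a h y)"
    unfolding k(2) by blast
  show ?thesis
  proof (rule that)
    show "integrable lborel (\<lambda>x. (s * (1 - a)) * \<kappa> x + (s * a) * \<kappa> (- x))" by (rule r[OF \<kappa>(1)])
    show "hartley_of a (\<lambda>x. (s * (1 - a)) * \<kappa> x + (s * a) * \<kappa> (- x)) y = hartley_of a h y / (1 + hartley_of a h y)" for y
    proof -
      define K K' where "K = fourier \<kappa> y" "K' = fourier \<kappa> (- y)"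
      have "a * ((1 - a) * K + a * K') + (1 - a) * ((1 - a) * K' + a * K) = K"
        using a_square by algebra
      moreover have "a * (s * (1 - a) * K + s * a * K') + (1 - a) * (s * (1 - a) * K' + s * a * K)
          = s * (a * ((1 - a) * K + a * K') + (1 - a) * ((1 - a) * K' + a * K))"
        by (simp only: distrib_left mult_ac)
      ultimately have "(a * (s * (1 - a) * K + s * a * K') + (1 - a) * (s * (1 - a) * K' + s * a * K)) / s = K"
        using s by simp
      then show ?thesis
        unfolding hartley_of_def[of a "\<lambda>x. (s * (1 - a)) * \<kappa> x + (s * a) * \<kappa> (- x)"] Fr[OF \<kappa>(1)] minus_minus
          s_def[symmetric] \<kappa>(2)[symmetric] K_K'_def .
    qed
  qed
qed

end

section \<open>The integro-differential equation\<close>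

lemma integrable_exp_neg_abs: "integrable lborel (\<lambda>x::real. exp (- \<bar>x\<bar>))"
proof (rule Bochner_Integration.integrable_bound)
  show "integrable lborel (\<lambda>x::real. 2 / (1 + x\<^sup>2))"
    using integrable_inverse_1_plus_square by (simp add: set_integrable_def divide_inverse)
  have "exp (- \<bar>x\<bar>) \<le> 2 / (1 + x\<^sup>2)" for x :: real
  proof -
    have "(1 + x\<^sup>2) / 2 \<le> exp \<bar>x\<bar>"
      using exp_lower_Taylor_quadratic[of "\<bar>x\<bar>"] by simp
    then have "inverse (exp \<bar>x\<bar>) \<le> inverse ((1 + x\<^sup>2) / 2)"
      by (intro le_imp_inverse_le) (auto simp: add_pos_nonneg)
    then show ?thesis by (simp add: exp_minus)
  qed
  then show "AE x :: real in lborel. norm (exp (- \<bar>x\<bar>)) \<le> norm (2 / (1 + x\<^sup>2))"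
    by simp
qed measurable

text \<open>At almost every point the second derivative of \<open>f * g\<close> exists and is \<open>f * g - f\<close>. Second
derivatives are unique, so the number \<open>d\<close> in the equation has no other choice there, and the equation becomes
one without derivatives.\<close>

lemma solves_equation_iff:
  assumes f: "integrable lborel f0" "AE x in lborel. f x = f0 x"
    and h: "integrable lborel h0" "AE x in lborel. h x = h0 x"
    and \<xi>: "integrable lborel \<xi>0" "AE x in lborel. \<xi> x = \<xi>0 x"
    and g: "g = (\<lambda>x. of_real (sqrt (pi / 2) * exp (- \<bar>x\<bar>)))"
  shows "solves_equation g h \<xi> f \<longleftrightarrow>
    (AE x in lborel. f0 x + hartley_conv f0 h0 x = hartley_conv h0 \<xi>0 x)"
proof -
  have g_int: "integrable lborel g" unfolding g using integrable_exp_neg_abs by (intro integrable_of_real integrable_mult_right)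
  define u where "u = hartley_conv f g"
  have u: "u = (\<lambda>x. (1/2) * (LINT y|lborel. f0 y * of_real (exp (- \<bar>x - y\<bar>))))"
  proof
    fix x
    have "g (x + y) + g (x - y) + g (- x + y) - g (- x - y) = of_real (2 * sqrt (pi / 2)) * of_real (exp (- \<bar>x - y\<bar>))" for y
    proof -
      have "\<bar>- x + y\<bar> = \<bar>x - y\<bar>" "\<bar>- x - y\<bar> = \<bar>x + y\<bar>" by auto
      then show ?thesis by (simp only: g) simp
    qed
    then have "u x = (1 / (2 * sqrt (2 * pi))) *\<^sub>R (of_real (2 * sqrt (pi / 2)) * (LINT y|lborel. f0 y * of_real (exp (- \<bar>x - y\<bar>))))"
      unfolding u_def hartley_conv_eq_lborel[OF f(1) g_int f(2) AE_I2[OF refl]]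
      by (simp only: mult.left_commute[of "f0 y" "of_real (2 * sqrt (pi / 2))" for y] integral_mult_right_zero)
    also have "\<dots> = of_real (2 * sqrt (pi / 2) / (2 * sqrt (2 * pi))) * (LINT y|lborel. f0 y * of_real (exp (- \<bar>x - y\<bar>)))"
      by (simp add: scaleR_conv_of_real)
    also have "2 * sqrt (pi / 2) / (2 * sqrt (2 * pi)) = 1/2"
      by (simp add: real_sqrt_divide real_sqrt_mult field_simps)
    finally show "u x = (1/2) * (LINT y|lborel. f0 y * of_real (exp (- \<bar>x - y\<bar>)))" by simp
  qed
  have sd: "AE x in lborel. has_second_derivative u (u x - f0 x) x"
    by (rule AE_second_derivative_exp_conv[OF f(1) u])
  have c: "hartley_conv f h = hartley_conv f0 h0" "hartley_conv h \<xi> = hartley_conv h0 \<xi>0"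
    using f h \<xi> by (auto intro: hartley_conv_cong_AE)
  have "solves_equation g h \<xi> f \<longleftrightarrow> (AE x in lborel. \<exists>d. has_second_derivative u d x \<and>
        (u x - d) + hartley_conv f0 h0 x = hartley_conv h0 \<xi>0 x)"
    unfolding solves_equation_def c u_def[symmetric] by (simp add: AE_completion_iff)
  also have "\<dots> \<longleftrightarrow> (AE x in lborel. f0 x + hartley_conv f0 h0 x = hartley_conv h0 \<xi>0 x)"
  proof
    assume "AE x in lborel. \<exists>d. has_second_derivative u d x \<and> (u x - d) + hartley_conv f0 h0 x = hartley_conv h0 \<xi>0 x"
    with sd show "AE x in lborel. f0 x + hartley_conv f0 h0 x = hartley_conv h0 \<xi>0 x"
    proof eventually_elim
      case (elim x)
      then obtain d where "has_second_derivative u d x" "(u x - d) + hartley_conv f0 h0 x = hartley_conv h0 \<xi>0 x" by blast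
      with has_second_derivative_unique[OF elim(1)] show ?case by (metis diff_diff_eq2 add_diff_cancel_left')
    qed
  next
    assume "AE x in lborel. f0 x + hartley_conv f0 h0 x = hartley_conv h0 \<xi>0 x"
    with sd show "AE x in lborel. \<exists>d. has_second_derivative u d x \<and> (u x - d) + hartley_conv f0 h0 x = hartley_conv h0 \<xi>0 x"
    proof eventually_elim
      case (elim x)
      then show ?case by (intro exI[of _ "u x - f0 x"]) simp
    qed
  qed
  finally show ?thesis .
qed

theorem theorem4p4:
  fixes H :: "(real \<Rightarrow> complex) \<Rightarrow> real \<Rightarrow> complex"
    and \<xi> g h :: "real \<Rightarrow> complex"
  assumes "H \<in> {hartley1, hartley2}"
    and "integrable lebesgue \<xi>"
    and "g = (\<lambda>x. of_real (sqrt (pi / 2) * exp (- \<bar>x\<bar>)))"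
    and "integrable lebesgue h"
    and "\<forall>y. 1 + H h y \<noteq> 0"
  shows "\<exists>\<eta>.
     integrable lebesgue \<eta> \<and>
     (\<forall>y. H \<eta> y = H h y / (1 + H h y)) \<and>
     (\<forall>\<eta>'. integrable lebesgue \<eta>' \<and> (\<forall>y. H \<eta>' y = H h y / (1 + H h y)) \<longrightarrow>
        (AE x in lebesgue. \<eta>' x = \<eta> x)) \<and>
     integrable lebesgue (hartley_conv \<eta> \<xi>) \<and>
     solves_equation g h \<xi> (hartley_conv \<eta> \<xi>) \<and>
     (\<forall>f. integrable lebesgue f \<and> solves_equation g h \<xi> f \<longrightarrow>
        (AE x in lebesgue. f x = hartley_conv \<eta> \<xi> x)) \<and>
     L1_norm (hartley_conv \<eta> \<xi>) \<le> sqrt (2 / pi) * L1_norm \<eta> * L1_norm \<xi>"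
proof -
  obtain \<xi>0 where \<xi>: "integrable lborel \<xi>0" "AE x in lborel. \<xi> x = \<xi>0 x"
    using lborel_representative[OF assms(2)] by blast
  obtain h0 where h: "integrable lborel h0" "AE x in lborel. h x = h0 x"
    using lborel_representative[OF assms(4)] by blast
  obtain a where a: "a * a + (1 - a) * (1 - a) = 0"
    and H: "\<And>f f0 y. integrable lborel f0 \<Longrightarrow> AE x in lborel. f x = f0 x \<Longrightarrow> H f y = hartley_of a f0 y"
    using hartley_eq_hartley_of[OF assms(1)] by blast
  have Hh: "H h y = hartley_of a h0 y" for y by (rule H[OF h])
  have nz: "1 + hartley_of a h0 y \<noteq> 0" for y using assms(5) by (simp add: Hh)
  obtain \<eta> where \<eta>: "integrable lborel \<eta>" "\<And>y. hartley_of a \<eta> y = hartley_of a h0 y / (1 + hartley_of a h0 y)"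
    using hartley_of_wiener[OF a h(1) nz] by blast
  define w where "w = hartley_conv \<eta> \<xi>0"
  have w: "hartley_conv \<eta> \<xi> = w"
    unfolding w_def using \<eta>(1) \<xi> by (intro hartley_conv_cong_AE) auto
  have wi: "integrable lborel w" unfolding w_def by (rule integrable_hartley_conv[OF \<eta>(1) \<xi>(1)])
  \<comment> \<open>Both sides of the equation without derivatives are integrable, so it may be tested on Hartley
transforms, where division by \<open>1 + H h\<close> is possible. Existence and uniqueness are the two directions.\<close>
  have solves: "solves_equation g h \<xi> f \<longleftrightarrow> (AE x in lborel. f0 x = w x)"
    if f: "integrable lborel f0" "AE x in lborel. f x = f0 x" for f f0
  proof -
    have i1: "integrable lborel (\<lambda>x. f0 x + hartley_conv f0 h0 x)"
      using f(1) integrable_hartley_conv[OF f(1) h(1)] by simp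
    have i2: "integrable lborel (hartley_conv h0 \<xi>0)" by (rule integrable_hartley_conv[OF h(1) \<xi>(1)])
    have lhs: "hartley_of a (\<lambda>x. f0 x + hartley_conv f0 h0 x) y = hartley_of a f0 y * (1 + hartley_of a h0 y)" for y
      using hartley_of_add[OF f(1) integrable_hartley_conv[OF f(1) h(1)]] hartley_of_conv[OF a f(1) h(1)]
      by (simp add: distrib_left)
    have rhs: "hartley_of a (hartley_conv h0 \<xi>0) y = hartley_of a w y * (1 + hartley_of a h0 y)" for y
      unfolding w_def hartley_of_conv[OF a h(1) \<xi>(1)] hartley_of_conv[OF a \<eta>(1) \<xi>(1)] \<eta>(2) using nz[of y] by simp
    have "solves_equation g h \<xi> f \<longleftrightarrow> (AE x in lborel. f0 x + hartley_conv f0 h0 x = hartley_conv h0 \<xi>0 x)"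
      by (rule solves_equation_iff[OF f h \<xi> assms(3)])
    also have "\<dots> \<longleftrightarrow> (\<forall>y. hartley_of a f0 y * (1 + hartley_of a h0 y) = hartley_of a w y * (1 + hartley_of a h0 y))"
      using hartley_of_unique[OF a i1 i2] hartley_of_cong_AE[OF i1 i2, where a = a] unfolding lhs rhs by blast
    also have "\<dots> \<longleftrightarrow> (\<forall>y. hartley_of a f0 y = hartley_of a w y)" using nz by simp
    also have "\<dots> \<longleftrightarrow> (AE x in lborel. f0 x = w x)"
      using hartley_of_unique[OF a f(1) wi] hartley_of_cong_AE[OF f(1) wi, where a = a] by blast
    finally show ?thesis .
  qed
  show ?thesis
  proof (intro exI[of _ \<eta>] conjI allI impI; (elim conjE)?)
    show "integrable lebesgue \<eta>" by (rule integrable_lebesgue_of_lborel[OF \<eta>(1)])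
    show "H \<eta> y = H h y / (1 + H h y)" for y
      using H[OF \<eta>(1), of \<eta> y] by (simp add: Hh \<eta>(2))
    show "integrable lebesgue (hartley_conv \<eta> \<xi>)"
      unfolding w by (rule integrable_lebesgue_of_lborel[OF wi])
    show "solves_equation g h \<xi> (hartley_conv \<eta> \<xi>)"
      unfolding w using solves[OF wi, of w] by simp
    show "L1_norm (hartley_conv \<eta> \<xi>) \<le> sqrt (2 / pi) * L1_norm \<eta> * L1_norm \<xi>"
      unfolding w L1_norm_eq[OF wi AE_I2[OF refl]] L1_norm_eq[OF \<eta>(1) AE_I2[OF refl]] L1_norm_eq[OF \<xi>]
      unfolding w_def by (rule norm_hartley_conv_le[OF \<eta>(1) \<xi>(1)])
  next
    fix \<eta>' assume i: "integrable lebesgue \<eta>'" and e: "\<forall>y. H \<eta>' y = H h y / (1 + H h y)"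
    obtain \<eta>0 where \<eta>0: "integrable lborel \<eta>0" "AE x in lborel. \<eta>' x = \<eta>0 x"
      using lborel_representative[OF i] by blast
    have "hartley_of a \<eta>0 y = hartley_of a \<eta> y" for y
      using e H[OF \<eta>0, of y] by (simp add: Hh \<eta>(2))
    from hartley_of_unique[OF a \<eta>0(1) \<eta>(1) this] \<eta>0(2) have "AE x in lborel. \<eta>' x = \<eta> x"
      by eventually_elim simp
    then show "AE x in lebesgue. \<eta>' x = \<eta> x" by (simp add: AE_completion_iff)
  next
    fix f assume i: "integrable lebesgue f" and e: "solves_equation g h \<xi> f"
    obtain f0 where f0: "integrable lborel f0" "AE x in lborel. f x = f0 x"
      using lborel_representative[OF i] by blast
    from solves[OF f0] e have "AE x in lborel. f0 x = w x" by simp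
    with f0(2) have "AE x in lborel. f x = w x" by eventually_elim simp
    then show "AE x in lebesgue. f x = hartley_conv \<eta> \<xi> x" by (simp add: AE_completion_iff w)
  qed
qed

end
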